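(* Let $c<d$ be real numbers, put $2\delta=d-c$, and let $f$ be a function defined and Riemann integrable on $[c,d]$. Let $\psi(u)=u-[u]-\tfrac12$, and let $a\in(c,d)$. (I) If $f(a-)$ exists, then $$\frac{f(a-)}{2}=\frac{1}{2\delta}\int_c^a f(u)\,du+\int_c^a \psi\!\left(\frac{u-a}{2\delta}\right)df(u)+f(c)\left(\frac12-\frac{a-c}{2\delta}\right).$$ (II) If $f(a+)$ exists, then $$\frac{f(a+)}{2}=\frac{1}{2\delta}\int_a^d f(u)\,du-\int_a^d \psi\!\left(\frac{a-u}{2\delta}\right)df(u)+f(d)\left(\frac12-\frac{d-a}{2\delta}\right).$$ (III) If both $f(a+)$ and $f(a-)$ exist and $f(c)=f(d)$, then $$\frac{f(a+)+f(a-)}{2}=\frac{1}{2\delta}\int_c^d f(u)\,du+\int_c^d \psi\!\left(\frac{u-a}{2\delta}\right)df(u).$$ If, in addition, summation and integration can be interchanged in this Riemann–Stieltjes integral, i.e. $$\int_c^d\Big(\sum_{|n|\ge1}\frac{e^{2\pi i n\frac{u-a}{2\delta}}}{2\pi i n}\Big)df(u)=\sum_{|n|\ge1}\frac{1}{2\pi i n}\int_c^d e^{2\pi i n\frac{u-a}{2\delta}}\,df(u),$$ then $$\frac{f(a+)+f(a-)}{2}=\sum_{n=-\infty}^{\infty}c_n e^{\frac{\pi i n a}{\delta}},\qquad c_n=\frac{1}{2\delta}\int_c^d f(u)e^{-\frac{\pi i n u}{\delta}}\,du.$$ Otherwise (without the interchange hypothesis, but still assuming $f(a\pm)$ exist and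 $f(c)=f(d)$), the series $\sum_{n}c_n e^{\pi i n a/\delta}$ converges to $\frac{f(a+)+f(a-)}{2}$ in the Cesàro $(C,1)$ sense: with $S_\ell=\sum_{n=-\ell}^{\ell}c_n e^{\pi i n a/\delta}$, one has $\lim_{N\to\infty}\frac1N\sum_{\ell=1}^{N}S_\ell=\frac{f(a+)+f(a-)}{2}$.
   Context: $[u]$ denotes the integer part of the real number $u$, and $\psi(u)=u-[u]-\tfrac12$. For $x\in[c,d)$, $f(x+)=\lim_{\epsilon\to0^+}f(x+\epsilon)$ and for $x\in(c,d]$, $f(x-)=\lim_{\epsilon\to0^+}f(x-\epsilon)$, whenever these limits exist. Integrals of the form $\int g\,df$ are Riemann–Stieltjes integrals. The numbers $c_n$ are the (exponential) Fourier coefficients of $f$ on $[c,d]$, and $\sum_{n=-\infty}^\infty$ denotes the limit of the symmetric partial sums $\sum_{n=-N}^{N}$ as $N\to\infty$. $\sum_{|n|\ge1}$ runs over nonzero integers $n$ (summed symmetrically). A series is $(C,1)$ (Cesàro) summable to $s$ if the arithmetic means of its partial sums converge to $s$.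
   Formalization: Where f jumps at a, the Riemann–Stieltjes integrals of ψ (and of the sine series) do not exist; they are read as improper at a (limits of integrals over [c,b], b→a−, and [b,d], b→a+), and as ordinary integrals when f is (one-sidedly) continuous at a. *)

theory Defs
  imports "HOL-Analysis.Analysis"
begin

definition psi :: "real \<Rightarrow> real" where
  "psi u = u - of_int \<lfloor>u\<rfloor> - 1/2"

definition tagged_partition ::
    "real \<Rightarrow> real \<Rightarrow> real \<Rightarrow> nat \<Rightarrow> (nat \<Rightarrow> real) \<Rightarrow> (nat \<Rightarrow> real) \<Rightarrow> bool" where
  "tagged_partition \<eta> a b n x t \<longleftrightarrow>
     x 0 = a \<and> x n = b \<and>
     (\<forall>i<n. x i \<le> t i \<and> t i \<le> x (Suc i) \<and> x (Suc i) - x i < \<eta>)"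

text \<open>The Riemann--Stieltjes integral of \<open>g\<close> with respect to \<open>f\<close> over \<open>[a, b]\<close>, as the limit of
  Riemann--Stieltjes sums when the mesh tends to zero. No monotonicity or bounded variation of
  \<open>f\<close> is required. Degenerate subintervals are allowed; they contribute nothing to the sums.\<close>

definition has_rs_integral ::
    "(real \<Rightarrow> 'a) \<Rightarrow> (real \<Rightarrow> 'a) \<Rightarrow> real \<Rightarrow> real \<Rightarrow> 'a::real_normed_field \<Rightarrow> bool" where
  "has_rs_integral g f a b I \<longleftrightarrow>
     (\<forall>\<epsilon>>0. \<exists>\<eta>>0. \<forall>n x t. tagged_partition \<eta> a b n x t \<longrightarrow>
        norm ((\<Sum>i<n. g (t i) * (f (x (Suc i)) - f (x i))) - I) < \<epsilon>)"

definition riemann_integrable :: "(real \<Rightarrow> 'a::real_normed_field) \<Rightarrow> real \<Rightarrow> real \<Rightarrow> bool" where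
  "riemann_integrable f a b \<longleftrightarrow> (\<exists>I. has_rs_integral f of_real a b I)"

text \<open>When integrand and integrator are both discontinuous at the same point, the integral above does
  not exist. For instance \<open>\<lambda>u. psi ((u - a) / (2 * \<delta>))\<close> jumps at \<open>a\<close>, so its integral over
  \<open>[c, a]\<close> with respect to \<open>f\<close> only exists if \<open>f\<close> is left-continuous at \<open>a\<close>. At such
  a point the Riemann--Stieltjes integral has to be read as an improper one. It then depends on the
  one-sided limits of \<open>f\<close> at that point, but not on the values of \<open>g\<close> and \<open>f\<close> there.\<close>

definition has_rs_integral_left ::
    "(real \<Rightarrow> 'a) \<Rightarrow> (real \<Rightarrow> 'a) \<Rightarrow> real \<Rightarrow> real \<Rightarrow> 'a::real_normed_field \<Rightarrow> bool" where
  "has_rs_integral_left g f a b I \<longleftrightarrow>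
     (\<exists>J. (\<forall>x\<in>{a..<b}. has_rs_integral g f a x (J x)) \<and> (J \<longlongrightarrow> I) (at_left b))"

definition has_rs_integral_right ::
    "(real \<Rightarrow> 'a) \<Rightarrow> (real \<Rightarrow> 'a) \<Rightarrow> real \<Rightarrow> real \<Rightarrow> 'a::real_normed_field \<Rightarrow> bool" where
  "has_rs_integral_right g f a b I \<longleftrightarrow>
     (\<exists>J. (\<forall>x\<in>{a<..b}. has_rs_integral g f x b (J x)) \<and> (J \<longlongrightarrow> I) (at_right a))"

definition has_rs_integral_around ::
    "real \<Rightarrow> (real \<Rightarrow> 'a) \<Rightarrow> (real \<Rightarrow> 'a) \<Rightarrow> real \<Rightarrow> real \<Rightarrow> 'a::real_normed_field \<Rightarrow> bool" where
  "has_rs_integral_around p g f a b I \<longleftrightarrow>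
     (\<exists>I1 I2. has_rs_integral_left g f a p I1 \<and> has_rs_integral_right g f p b I2 \<and> I = I1 + I2)"

text \<open>All these integrals are unique, so a statement of the form \<open>\<exists>I. has_rs_integral g f a b I \<and> P I\<close>
  asserts that the integral exists and that its value satisfies \<open>P\<close>.\<close>

lemma tagged_partition_exists:
  assumes "a \<le> b" "\<eta> > 0"
  obtains n x t where "tagged_partition \<eta> a b n x t"
proof -
  obtain m :: nat where m: "(b - a) / \<eta> < real m" using reals_Archimedean2 by blast
  have m0: "real m > 0" using m assms by (smt (verit) divide_nonneg_pos)
  define x where "x i = a + real i * ((b - a) / real m)" for i
  have step: "x (Suc i) - x i = (b - a) / real m" for i
    by (simp add: x_def distrib_right add_divide_distrib)
  have "(b - a) / real m < \<eta>" using m m0 assms by (simp add: field_simps)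
  moreover have "(b - a) / real m \<ge> 0" using m0 assms by simp
  moreover have "x 0 = a" "x m = b" using m0 by (auto simp: x_def)
  ultimately have "tagged_partition \<eta> a b m x x"
    unfolding tagged_partition_def using step by (metis diff_ge_0_iff_ge order_refl)
  then show ?thesis by (rule that)
qed

lemma tagged_partition_mono:
  "tagged_partition \<eta> a b n x t \<Longrightarrow> \<eta> \<le> \<eta>' \<Longrightarrow> tagged_partition \<eta>' a b n x t"
  unfolding tagged_partition_def by (meson less_le_trans)

lemma has_rs_integral_unique:
  assumes "a \<le> b" "has_rs_integral g f a b I" "has_rs_integral g f a b I'"
  shows "I = I'"
proof (rule ccontr)
  assume "I \<noteq> I'"
  then have e: "norm (I - I') / 2 > 0" by simp
  obtain \<eta>1 where 1: "\<eta>1 > 0" "\<And>n x t. tagged_partition \<eta>1 a b n x t \<Longrightarrow>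
      norm ((\<Sum>i<n. g (t i) * (f (x (Suc i)) - f (x i))) - I) < norm (I - I') / 2"
    using assms(2) e unfolding has_rs_integral_def by meson
  obtain \<eta>2 where 2: "\<eta>2 > 0" "\<And>n x t. tagged_partition \<eta>2 a b n x t \<Longrightarrow>
      norm ((\<Sum>i<n. g (t i) * (f (x (Suc i)) - f (x i))) - I') < norm (I - I') / 2"
    using assms(3) e unfolding has_rs_integral_def by meson
  obtain n x t where p: "tagged_partition (min \<eta>1 \<eta>2) a b n x t"
    using tagged_partition_exists[OF assms(1)] 1(1) 2(1) by (metis min_less_iff_conj)
  define S where "S = (\<Sum>i<n. g (t i) * (f (x (Suc i)) - f (x i)))"
  have "norm (S - I) < norm (I - I') / 2" "norm (S - I') < norm (I - I') / 2"
    unfolding S_def by (rule 1(2) 2(2), rule tagged_partition_mono[OF p], simp)+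
  then have "norm ((S - I') - (S - I)) < norm (I - I')"
    using norm_triangle_ineq4[of "S - I'" "S - I"] by linarith
  then show False by simp
qed

lemma has_rs_integral_left_unique:
  assumes "a < b" "has_rs_integral_left g f a b I" "has_rs_integral_left g f a b I'"
  shows "I = I'"
proof -
  obtain J where J: "\<forall>x\<in>{a..<b}. has_rs_integral g f a x (J x)" "(J \<longlongrightarrow> I) (at_left b)"
    using assms(2) unfolding has_rs_integral_left_def by blast
  obtain J' where J': "\<forall>x\<in>{a..<b}. has_rs_integral g f a x (J' x)" "(J' \<longlongrightarrow> I') (at_left b)"
    using assms(3) unfolding has_rs_integral_left_def by blast
  have eq: "J x = J' x" if "x \<in> {a<..<b}" for x
    by (rule has_rs_integral_unique[of a x g f]) (use that J(1) J'(1) in auto)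
  have "eventually (\<lambda>x. J x = J' x) (at_left b)"
    using eventually_at_left_real[OF assms(1)] by eventually_elim (rule eq)
  then have "(J' \<longlongrightarrow> I) (at_left b)" using J(2) by (simp add: filterlim_cong)
  then show ?thesis using J'(2) tendsto_unique trivial_limit_at_left_real by blast
qed

lemma has_rs_integral_right_unique:
  assumes "a < b" "has_rs_integral_right g f a b I" "has_rs_integral_right g f a b I'"
  shows "I = I'"
proof -
  obtain J where J: "\<forall>x\<in>{a<..b}. has_rs_integral g f x b (J x)" "(J \<longlongrightarrow> I) (at_right a)"
    using assms(2) unfolding has_rs_integral_right_def by blast
  obtain J' where J': "\<forall>x\<in>{a<..b}. has_rs_integral g f x b (J' x)" "(J' \<longlongrightarrow> I') (at_right a)"
    using assms(3) unfolding has_rs_integral_right_def by blast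
  have eq: "J x = J' x" if "x \<in> {a<..<b}" for x
    by (rule has_rs_integral_unique[of x b g f]) (use that J(1) J'(1) in auto)
  have "eventually (\<lambda>x. J x = J' x) (at_right a)"
    using eventually_at_right_real[OF assms(1)] by eventually_elim (rule eq)
  then have "(J' \<longlongrightarrow> I) (at_right a)" using J(2) by (simp add: filterlim_cong)
  then show ?thesis using J'(2) tendsto_unique trivial_limit_at_right_real by blast
qed

lemma has_rs_integral_around_unique:
  assumes "a < p" "p < b"
    "has_rs_integral_around p g f a b I" "has_rs_integral_around p g f a b I'"
  shows "I = I'"
  using assms has_rs_integral_left_unique[of a p] has_rs_integral_right_unique[of p b]
  unfolding has_rs_integral_around_def by metis

end

theory Submission
  imports Defs
begin

text \<open>On each side of \<open>a\<close> the function \<open>\<lambda>u. psi ((u - a) / (2 * \<delta>))\<close> is affine, so (I) and (II) are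
  integration by parts for Riemann--Stieltjes integrals, followed by the limit at \<open>a\<close>. If \<open>f\<close> is
  continuous at \<open>a\<close>, the proper integral exists because the jump of \<open>psi\<close> contributes the
  integral of a Heaviside function, which telescopes. The first claim of (III) is the sum of
  (I) and (II).

  The series \<open>\<Sum> exp (2 \<pi> i n w) / (2 \<pi> i n)\<close> over \<open>n \<noteq> 0\<close> converges to \<open>- psi w\<close> off the
  integers. Integration by parts turns \<open>1 / (2 \<pi> i n)\<close> times the integral of the \<open>n\<close>-th exponential
  against \<open>df\<close> into minus the \<open>-n\<close>-th term of the Fourier series, so interchanging sum and integral
  makes the formula for \<open>(f(a+) + f(a-)) / 2\<close> the Fourier series. Without the interchange, one
  splits \<open>f\<close> into a step function with values \<open>f(a-)\<close> and \<open>f(a+)\<close>, whose partial sums converge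
  by the sawtooth series, and a remainder that tends to \<open>0\<close> at \<open>a\<close>, which Fejer's kernel kills.\<close>

section \<open>Riemann integrability\<close>

text \<open>Riemann integrability of \<open>f\<close> alone guarantees no Stieltjes integral against
  \<open>df\<close>. Integration by parts turns the question into integrating \<open>f\<close>
  against a smooth integrator, and there \<open>osc_null\<close> suffices: the error on a cell is an
  oscillation of \<open>f\<close> times the length of the cell. The same criterion gives
  boundedness, passes to subintervals, and gives absolute integrability, so it links limits of
  Riemann sums to the gauge integral \<open>integral\<close> of the statement. One-sided limits at
  \<open>a\<close> do not force the Fourier series to converge, since \<open>f\<close> may have
  unbounded variation; hence Cesaro means. Fejer's kernel is applied only to a part of
  \<open>f\<close> with limit 0 at \<open>a\<close>. The jump part needs no kernel estimate, because
  the Dirichlet kernel has an explicit antiderivative: asymptotically each side of \<open>a\<close>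
  carries half of its mass, which is where the mean of the two one-sided limits comes from.\<close>

text \<open>Darboux's criterion, phrased with two choices of tags instead of suprema and infima over the
  cells.\<close>

definition osc_null :: "(real \<Rightarrow> 'a::real_normed_vector) \<Rightarrow> real \<Rightarrow> real \<Rightarrow> bool" where
  "osc_null f a b \<longleftrightarrow> (\<forall>\<epsilon>>0. \<exists>\<eta>>0. \<forall>n x t s.
     tagged_partition \<eta> a b n x t \<longrightarrow> tagged_partition \<eta> a b n x s \<longrightarrow>
     (\<Sum>i<n. norm (f (t i) - f (s i)) * (x (Suc i) - x i)) < \<epsilon>)"

lemma osc_nullD:
  assumes "osc_null f a b" "\<epsilon> > 0"
  obtains \<eta> where "\<eta> > 0" "\<And>n x t s. tagged_partition \<eta> a b n x t \<Longrightarrow>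
     tagged_partition \<eta> a b n x s \<Longrightarrow> (\<Sum>i<n. norm (f (t i) - f (s i)) * (x (Suc i) - x i)) < \<epsilon>"
  using assms unfolding osc_null_def by blast

lemma has_rs_integralD:
  assumes "has_rs_integral g f a b I" "\<epsilon> > 0"
  obtains \<eta> where "\<eta> > 0" "\<And>n x t. tagged_partition \<eta> a b n x t \<Longrightarrow>
     norm ((\<Sum>i<n. g (t i) * (f (x (Suc i)) - f (x i))) - I) < \<epsilon>"
  using assms unfolding has_rs_integral_def by blast

section \<open>Order and concatenation of tagged partitions\<close>

lemma tagged_partition_le_Suc:
  "tagged_partition \<eta> a b n x t \<Longrightarrow> i < n \<Longrightarrow> x i \<le> x (Suc i)"
  unfolding tagged_partition_def by force

lemma tagged_partition_mono_points:
  assumes "tagged_partition \<eta> a b n x t" "i \<le> j" "j \<le> n"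
  shows "x i \<le> x j"
  using assms(2,3)
proof (induction j rule: dec_induct)
  case (step k)
  then show ?case using tagged_partition_le_Suc[OF assms(1), of k] by auto
qed simp

lemma tagged_partition_points:
  assumes "tagged_partition \<eta> a b n x t" "i \<le> n"
  shows "x i \<in> {a..b}"
  using tagged_partition_mono_points[OF assms(1), of 0 i]
    tagged_partition_mono_points[OF assms(1), of i n] assms
  unfolding tagged_partition_def by auto

lemma tagged_partition_tags:
  assumes "tagged_partition \<eta> a b n x t" "i < n"
  shows "t i \<in> {a..b}"
  using tagged_partition_points[OF assms(1), of i] tagged_partition_points[OF assms(1), of "Suc i"] assms
  unfolding tagged_partition_def by fastforce

lemma ex_cell_containing:
  fixes x :: "nat \<Rightarrow> real"
  assumes "x 0 \<le> u" "u \<le> x n" "n > 0"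
  shows "\<exists>i<n. x i \<le> u \<and> u \<le> x (Suc i)"
  using assms
proof (induction n)
  case (Suc n)
  show ?case
  proof (cases "n = 0 \<or> u \<ge> x n")
    case True
    then show ?thesis using Suc.prems by auto
  next
    case False
    then show ?thesis using Suc by (metis less_SucI linorder_not_le neq0_conv order_le_less)
  qed
qed simp

lemma tagged_partition_append:
  assumes p: "tagged_partition \<eta> a b n x t" and q: "tagged_partition \<eta> b c m y s"
  shows "tagged_partition \<eta> a c (n + m)
    (\<lambda>i. if i \<le> n then x i else y (i - n)) (\<lambda>i. if i < n then t i else s (i - n))"
proof -
  define X where "X i = (if i \<le> n then x i else y (i - n))" for i
  define T where "T i = (if i < n then t i else s (i - n))" for i
  have pe: "x 0 = a" "x n = b" and pc: "\<And>i. i < n \<Longrightarrow> x i \<le> t i \<and> t i \<le> x (Suc i) \<and> x (Suc i) - x i < \<eta>"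
    using p unfolding tagged_partition_def by auto
  have qe: "y 0 = b" "y m = c" and qc: "\<And>i. i < m \<Longrightarrow> y i \<le> s i \<and> s i \<le> y (Suc i) \<and> y (Suc i) - y i < \<eta>"
    using q unfolding tagged_partition_def by auto
  have X: "X (n + j) = y j" for j using pe qe by (cases j) (auto simp: X_def)
  have "X i \<le> T i \<and> T i \<le> X (Suc i) \<and> X (Suc i) - X i < \<eta>" if "i < n + m" for i
  proof (cases "i < n")
    case True
    then show ?thesis using pc[OF True] by (simp add: X_def T_def)
  next
    case False
    then obtain j where j: "i = n + j" by (metis le_iff_add not_less)
    then have "j < m" using that by simp
    then show ?thesis using qc[of j] X[of j] X[of "Suc j"] by (simp add: j T_def)
  qed
  moreover have "X 0 = a" using pe by (simp add: X_def)
  moreover have "X (n + m) = c" using X qe by simp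
  ultimately show ?thesis unfolding tagged_partition_def X_def T_def by blast
qed

lemma sum_lessThan_add:
  fixes g :: "nat \<Rightarrow> 'a::comm_monoid_add"
  shows "(\<Sum>i<n+m. g i) = (\<Sum>i<n. g i) + (\<Sum>i<m. g (n + i))"
  by (induction m) (auto simp: add.assoc)

text \<open>Both taggings are extended by one and the same tagged partition of the remaining piece.
  Its terms vanish because the two tags agree there, so the sum over the subinterval is already a
  sum over the whole interval.\<close>

lemma osc_null_left:
  assumes "osc_null f a c" "a \<le> b" "b \<le> c"
  shows "osc_null f a b"
  unfolding osc_null_def
proof (intro allI impI)
  fix \<epsilon> :: real assume "\<epsilon> > 0"
  then obtain \<eta> where \<eta>: "\<eta> > 0" "\<And>n x t s. tagged_partition \<eta> a c n x t \<Longrightarrow>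
     tagged_partition \<eta> a c n x s \<Longrightarrow> (\<Sum>i<n. norm (f (t i) - f (s i)) * (x (Suc i) - x i)) < \<epsilon>"
    using osc_nullD[OF assms(1)] by blast
  obtain m y r where q: "tagged_partition \<eta> b c m y r"
    using tagged_partition_exists assms(3) \<eta>(1) by blast
  show "\<exists>\<eta>>0. \<forall>n x t s. tagged_partition \<eta> a b n x t \<longrightarrow> tagged_partition \<eta> a b n x s \<longrightarrow>
     (\<Sum>i<n. norm (f (t i) - f (s i)) * (x (Suc i) - x i)) < \<epsilon>"
  proof (intro exI[of _ \<eta>] conjI allI impI \<eta>(1))
    fix n x t s assume p: "tagged_partition \<eta> a b n x t" "tagged_partition \<eta> a b n x s"
    show "(\<Sum>i<n. norm (f (t i) - f (s i)) * (x (Suc i) - x i)) < \<epsilon>"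
      using \<eta>(2)[OF tagged_partition_append[OF p(1) q] tagged_partition_append[OF p(2) q]]
      by (simp add: sum_lessThan_add)
  qed
qed

lemma osc_null_right:
  assumes "osc_null f a c" "a \<le> b" "b \<le> c"
  shows "osc_null f b c"
  unfolding osc_null_def
proof (intro allI impI)
  fix \<epsilon> :: real assume "\<epsilon> > 0"
  then obtain \<eta> where \<eta>: "\<eta> > 0" "\<And>n x t s. tagged_partition \<eta> a c n x t \<Longrightarrow>
     tagged_partition \<eta> a c n x s \<Longrightarrow> (\<Sum>i<n. norm (f (t i) - f (s i)) * (x (Suc i) - x i)) < \<epsilon>"
    using osc_nullD[OF assms(1)] by blast
  obtain m y r where q: "tagged_partition \<eta> a b m y r"
    using tagged_partition_exists assms(2) \<eta>(1) by blast
  show "\<exists>\<eta>>0. \<forall>n x t s. tagged_partition \<eta> b c n x t \<longrightarrow> tagged_partition \<eta> b c n x s \<longrightarrow>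
     (\<Sum>i<n. norm (f (t i) - f (s i)) * (x (Suc i) - x i)) < \<epsilon>"
  proof (intro exI[of _ \<eta>] conjI allI impI \<eta>(1))
    fix n x t s assume p: "tagged_partition \<eta> b c n x t" "tagged_partition \<eta> b c n x s"
    \<comment> \<open>\<open>tagged_partition_append\<close> takes the junction point from the first
      partition, so in the concatenation the first cell starts at \<open>y m\<close> instead of
      \<open>x 0\<close>.\<close>
    have x0: "y m = x 0" using p q unfolding tagged_partition_def by auto
    have "(\<Sum>i<n. norm (f (t i) - f (s i)) * (x (Suc i) - x i)) =
      (\<Sum>i<n. norm (f (t i) - f (s i)) * (x (Suc i) - (if i = 0 then y m else x i)))"
      using x0 by (intro sum.cong) auto
    then show "(\<Sum>i<n. norm (f (t i) - f (s i)) * (x (Suc i) - x i)) < \<epsilon>"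
      using \<eta>(2)[OF tagged_partition_append[OF q p(1)] tagged_partition_append[OF q p(2)]] x0
      by (simp add: sum_lessThan_add cong: if_cong)
  qed
qed

text \<open>Choosing the larger of two values needs an order, so the argument runs separately for
  \<open>Re\<close> and \<open>Im\<close>; \<open>h\<close> in \<open>key\<close> stands for either.
  Two Riemann sums within \<epsilon>/4 of the integral give \<epsilon>/2 per component.\<close>

lemma riemann_integrable_osc_null:
  fixes f :: "real \<Rightarrow> complex"
  assumes "riemann_integrable f a b"
  shows "osc_null f a b"
  unfolding osc_null_def
proof (intro allI impI)
  fix \<epsilon> :: real assume "\<epsilon> > 0"
  obtain I where "has_rs_integral f of_real a b I"
    using assms unfolding riemann_integrable_def by blast
  then obtain \<eta> where \<eta>: "\<eta> > 0" "\<And>n x t. tagged_partition \<eta> a b n x t \<Longrightarrow>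
     norm ((\<Sum>i<n. f (t i) * (of_real (x (Suc i)) - of_real (x i))) - I) < \<epsilon> / 4"
    using has_rs_integralD[of f of_real a b I "\<epsilon> / 4"] \<open>\<epsilon> > 0\<close> by auto
  have key: "(\<Sum>i<n. \<bar>h (f (t i)) - h (f (s i))\<bar> * (x (Suc i) - x i)) < \<epsilon> / 2"
    if p: "tagged_partition \<eta> a b n x t" "tagged_partition \<eta> a b n x s"
      and h: "\<And>z w. h (z + w) = h z + h w" "\<And>z r. h (z * complex_of_real r) = h z * r"
        "\<And>z. \<bar>h z\<bar> \<le> norm z" "h 0 = 0" "\<And>z w. h (z - w) = h z - h w"
    for n x t s and h :: "complex \<Rightarrow> real"
  proof -
    \<comment> \<open>Swapping tags where the difference is negative turns the sum of absolute values into a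
      difference of two Riemann sums.\<close>
    define P where "P i \<longleftrightarrow> h (f (s i)) \<le> h (f (t i))" for i
    define t' where "t' i = (if P i then t i else s i)" for i
    define s' where "s' i = (if P i then s i else t i)" for i
    define S where "S r = (\<Sum>i<n. f (r i) * (of_real (x (Suc i)) - of_real (x i)))" for r
    have q: "tagged_partition \<eta> a b n x t'" "tagged_partition \<eta> a b n x s'"
      using p unfolding tagged_partition_def t'_def s'_def by auto
    have hsum: "h (\<Sum>i<n. g i) = (\<Sum>i<n. h (g i))" for g
      by (induction n) (simp_all add: h)
    have "h (S r) = (\<Sum>i<n. h (f (r i)) * (x (Suc i) - x i))" for r
      unfolding S_def hsum by (simp add: h(2) flip: of_real_diff)
    then have "(\<Sum>i<n. \<bar>h (f (t i)) - h (f (s i))\<bar> * (x (Suc i) - x i)) = h (S t') - h (S s')"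
      by (auto simp: P_def t'_def s'_def algebra_simps simp flip: sum_subtractf intro!: sum.cong)
    also have "\<dots> = h (S t' - S s')" by (simp add: h)
    also have "\<dots> \<le> norm (S t' - S s')" using h(3) abs_le_D1 by blast
    also have "\<dots> = norm ((S t' - I) - (S s' - I))" by simp
    also have "\<dots> \<le> norm (S t' - I) + norm (S s' - I)" by (rule norm_triangle_ineq4)
    also have "\<dots> < \<epsilon> / 4 + \<epsilon> / 4" unfolding S_def by (intro add_strict_mono \<eta> q)
    finally show ?thesis by simp
  qed
  show "\<exists>\<eta>>0. \<forall>n x t s. tagged_partition \<eta> a b n x t \<longrightarrow> tagged_partition \<eta> a b n x s \<longrightarrow>
     (\<Sum>i<n. norm (f (t i) - f (s i)) * (x (Suc i) - x i)) < \<epsilon>"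
  proof (intro exI[of _ \<eta>] conjI allI impI \<eta>(1))
    fix n x t s assume p: "tagged_partition \<eta> a b n x t" "tagged_partition \<eta> a b n x s"
    have "(\<Sum>i<n. norm (f (t i) - f (s i)) * (x (Suc i) - x i)) \<le>
      (\<Sum>i<n. \<bar>Re (f (t i)) - Re (f (s i))\<bar> * (x (Suc i) - x i)
           + \<bar>Im (f (t i)) - Im (f (s i))\<bar> * (x (Suc i) - x i))"
    proof (rule sum_mono)
      fix i assume "i \<in> {..<n}"
      then have "x (Suc i) - x i \<ge> 0" using tagged_partition_le_Suc[OF p(1)] by auto
      then have "norm (f (t i) - f (s i)) * (x (Suc i) - x i)
         \<le> (\<bar>Re (f (t i)) - Re (f (s i))\<bar> + \<bar>Im (f (t i)) - Im (f (s i))\<bar>) * (x (Suc i) - x i)"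
        using cmod_le[of "f (t i) - f (s i)"] by (intro mult_right_mono) auto
      then show "norm (f (t i) - f (s i)) * (x (Suc i) - x i)
         \<le> \<bar>Re (f (t i)) - Re (f (s i))\<bar> * (x (Suc i) - x i)
           + \<bar>Im (f (t i)) - Im (f (s i))\<bar> * (x (Suc i) - x i)" by (simp add: distrib_right)
    qed
    also have "\<dots> < \<epsilon> / 2 + \<epsilon> / 2"
      unfolding sum.distrib
      by (intro add_strict_mono key p) (auto simp: abs_Re_le_cmod abs_Im_le_cmod)
    finally show "(\<Sum>i<n. norm (f (t i) - f (s i)) * (x (Suc i) - x i)) < \<epsilon>" by simp
  qed
qed

text \<open>Fix one fine partition. Moving a single tag to \<open>u\<close> changes the oscillation
  sum only in one cell, so \<open>norm (f (t i) - f u)\<close> times the length of that cell is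
  below 1.\<close>

lemma osc_null_bounded:
  assumes "osc_null f a b"
  obtains B where "B > 0" "\<And>u. u \<in> {a..b} \<Longrightarrow> norm (f u) \<le> B"
proof (cases "a < b")
  case False
  then have "norm (f u) \<le> norm (f a) + 1" if "u \<in> {a..b}" for u
    using that by (cases "u = a") auto
  then show ?thesis by (intro that[of "norm (f a) + 1"]) (auto simp: add_nonneg_pos)
next
  case True
  obtain \<eta> where \<eta>: "\<eta> > 0" "\<And>n x t s. tagged_partition \<eta> a b n x t \<Longrightarrow>
     tagged_partition \<eta> a b n x s \<Longrightarrow> (\<Sum>i<n. norm (f (t i) - f (s i)) * (x (Suc i) - x i)) < 1"
    using osc_nullD[OF assms zero_less_one] by blast
  obtain n x t where p: "tagged_partition \<eta> a b n x t"
    using tagged_partition_exists True \<eta>(1) by (metis less_imp_le)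
  then have n: "n > 0" and ends: "x 0 = a" "x n = b"
    using True unfolding tagged_partition_def by (auto intro: gr0I)
  \<comment> \<open>\<open>C i\<close> bounds \<open>f\<close> on cell \<open>i\<close>. On a
    degenerate cell the quotient is 1/0 = 0 and the tag is the only point. Summing all
    \<open>C i\<close> serves as a crude maximum.\<close>
  define C where "C i = norm (f (t i)) + 1 / (x (Suc i) - x i)" for i
  have C0: "C i \<ge> 0" if "i < n" for i
    using tagged_partition_le_Suc[OF p that] unfolding C_def by auto
  have "norm (f u) \<le> (\<Sum>i<n. C i) + 1" if u: "u \<in> {a..b}" for u
  proof -
    obtain i where i: "i < n" "x i \<le> u" "u \<le> x (Suc i)"
      using ex_cell_containing[of x u n] u n ends by (metis atLeastAtMost_iff)
    have q: "tagged_partition \<eta> a b n x (t(i := u))"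
      using p i unfolding tagged_partition_def by auto
    have ti: "x i \<le> t i" "t i \<le> x (Suc i)" using p i unfolding tagged_partition_def by auto
    have "norm (f u) \<le> C i"
    proof (cases "x i = x (Suc i)")
      case True
      then have "t i = u" using i ti by simp
      then show ?thesis unfolding C_def using True by simp
    next
      case False
      then have pos: "x (Suc i) - x i > 0" using i by simp
      have "norm (f (t i) - f u) * (x (Suc i) - x i) \<le>
        (\<Sum>j<n. norm (f (t j) - f ((t(i := u)) j)) * (x (Suc j) - x j))"
        using i(1) by (subst sum.remove[of _ i]) (auto intro!: sum_nonneg)
      also have "\<dots> < 1" by (rule \<eta>(2)[OF p q])
      finally have "norm (f (t i) - f u) < 1 / (x (Suc i) - x i)" using pos by (simp add: field_simps)
      then show ?thesis unfolding C_def using norm_triangle_sub[of "f u" "f (t i)"]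
        by (simp add: norm_minus_commute)
    qed
    also have "\<dots> \<le> (\<Sum>i<n. C i)" using i(1) C0 by (intro member_le_sum) auto
    finally show ?thesis by simp
  qed
  moreover have "(\<Sum>i<n. C i) + 1 > 0" using C0 by (intro add_nonneg_pos sum_nonneg) auto
  ultimately show ?thesis by (rule that[rotated])
qed

text \<open>A bounded function need not attain its supremum on a cell. A point that is optimal up to
  \<kappa> can be used as a tag, so suprema and infima are replaced by tags throughout.\<close>

lemma bounded_near_maximum:
  fixes h :: "'a \<Rightarrow> real"
  assumes "S \<noteq> {}" "\<And>u. u \<in> S \<Longrightarrow> h u \<le> B" "\<kappa> > 0"
  obtains t where "t \<in> S" "\<And>u. u \<in> S \<Longrightarrow> h u \<le> h t + \<kappa>"
proof -
  have bdd: "bdd_above (h ` S)" using assms(2) by (auto simp: bdd_above_def)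
  have "Sup (h ` S) - \<kappa> < Sup (h ` S)" using assms(3) by simp
  then obtain t where t: "t \<in> S" "Sup (h ` S) - \<kappa> < h t"
    using less_cSup_iff[OF _ bdd] assms(1) by auto
  have "h u \<le> h t + \<kappa>" if "u \<in> S" for u
    using cSup_upper[OF imageI[OF that, of h] bdd] t(2) by linarith
  with t(1) show ?thesis by (rule that)
qed

section \<open>Squeezing between step functions: gauge and absolute integrability\<close>

lemma has_integral_step_function:
  fixes x :: "nat \<Rightarrow> real" and v :: "nat \<Rightarrow> real"
  assumes "\<And>i. i < n \<Longrightarrow> x i \<le> x (Suc i)"
    and "\<And>i u. i < n \<Longrightarrow> x i < u \<Longrightarrow> u < x (Suc i) \<Longrightarrow> g u = v i"
  shows "x 0 \<le> x n \<and> (g has_integral (\<Sum>i<n. v i * (x (Suc i) - x i))) {x 0..x n}"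
  using assms
proof (induction n)
  case 0
  then show ?case using has_integral_refl(2)[of g "x 0"] by simp
next
  case (Suc n)
  have c: "((\<lambda>_. v n) has_integral v n * (x (Suc n) - x n)) (cbox (x n) (x (Suc n)))"
    using has_integral_const_real[of "v n" "x n" "x (Suc n)"] Suc.prems(1)[of n]
    by (simp add: mult.commute)
  have "(g has_integral v n * (x (Suc n) - x n)) (cbox (x n) (x (Suc n)))"
    by (rule has_integral_spike_interior[OF c]) (use Suc.prems(2)[of n] in auto)
  moreover have "x 0 \<le> x n" "(g has_integral (\<Sum>i<n. v i * (x (Suc i) - x i))) {x 0..x n}"
    using Suc by auto
  moreover have "x n \<le> x (Suc n)" using Suc.prems(1) by auto
  ultimately show ?case using has_integral_combine[of "x 0" "x n" "x (Suc n)"] by simp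
qed

text \<open>Nearly maximal and nearly minimal tags define step functions above and below
  \<open>f\<close>. Their integrals differ by an oscillation sum plus
  \<open>2 * \<kappa> * (b - a)\<close>.\<close>

lemma osc_null_integrable_real:
  fixes f :: "real \<Rightarrow> real"
  assumes osc: "osc_null f a b" and "a \<le> b"
  shows "f integrable_on {a..b}"
proof -
  obtain B where B: "\<And>u. u \<in> {a..b} \<Longrightarrow> norm (f u) \<le> B" using osc_null_bounded[OF osc] by blast
  have "f integrable_on cbox a b"
  proof (rule integrable_straddle_interval)
    fix e :: real assume e: "e > 0"
    obtain \<eta> where \<eta>: "\<eta> > 0" "\<And>n x t s. tagged_partition \<eta> a b n x t \<Longrightarrow>
     tagged_partition \<eta> a b n x s \<Longrightarrow> (\<Sum>i<n. norm (f (t i) - f (s i)) * (x (Suc i) - x i)) < e / 2"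
      using osc_nullD[OF osc half_gt_zero[OF e]] by blast
    obtain n x r where p: "tagged_partition \<eta> a b n x r"
      using tagged_partition_exists assms(2) \<eta>(1) by blast
    \<comment> \<open>This makes \<open>2 * \<kappa> * (b - a)\<close> smaller than
      \<open>e / 2\<close>; the added 1 covers \<open>a = b\<close>.\<close>
    define \<kappa> where "\<kappa> = e / (4 * (b - a + 1))"
    have \<kappa>: "\<kappa> > 0" using e assms(2) unfolding \<kappa>_def by auto
    have ends: "x 0 = a" "x n = b" using p unfolding tagged_partition_def by auto
    have le: "x i \<le> x (Suc i)" if "i < n" for i using tagged_partition_le_Suc[OF p that] .
    have sub: "{x i..x (Suc i)} \<subseteq> {a..b}" if "i < n" for i
      using tagged_partition_points[OF p, of i] tagged_partition_points[OF p, of "Suc i"] that by auto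
    have "\<forall>i. \<exists>t. i < n \<longrightarrow> t \<in> {x i..x (Suc i)} \<and> (\<forall>u\<in>{x i..x (Suc i)}. f u \<le> f t + \<kappa>)"
    proof
      fix i show "\<exists>t. i < n \<longrightarrow> t \<in> {x i..x (Suc i)} \<and> (\<forall>u\<in>{x i..x (Suc i)}. f u \<le> f t + \<kappa>)"
      proof (cases "i < n")
        case True
        show ?thesis
          by (rule bounded_near_maximum[of "{x i..x (Suc i)}" f B \<kappa>])
            (use True le sub[OF True] B \<kappa> in \<open>auto simp: abs_le_iff\<close>)
      qed auto
    qed
    then obtain t where t: "\<And>i. i < n \<Longrightarrow> t i \<in> {x i..x (Suc i)}"
        "\<And>i u. i < n \<Longrightarrow> u \<in> {x i..x (Suc i)} \<Longrightarrow> f u \<le> f (t i) + \<kappa>" by metis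
    have "\<forall>i. \<exists>t. i < n \<longrightarrow> t \<in> {x i..x (Suc i)} \<and> (\<forall>u\<in>{x i..x (Suc i)}. - f u \<le> - f t + \<kappa>)"
    proof
      fix i show "\<exists>t. i < n \<longrightarrow> t \<in> {x i..x (Suc i)} \<and> (\<forall>u\<in>{x i..x (Suc i)}. - f u \<le> - f t + \<kappa>)"
      proof (cases "i < n")
        case True
        show ?thesis
          by (rule bounded_near_maximum[of "{x i..x (Suc i)}" "\<lambda>u. - f u" B \<kappa>])
            (use True le sub[OF True] B \<kappa> in \<open>auto simp: abs_le_iff\<close>)
      qed auto
    qed
    then obtain s where s: "\<And>i. i < n \<Longrightarrow> s i \<in> {x i..x (Suc i)}"
        "\<And>i u. i < n \<Longrightarrow> u \<in> {x i..x (Suc i)} \<Longrightarrow> - f u \<le> - f (s i) + \<kappa>" by metis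
    have pt: "tagged_partition \<eta> a b n x t" "tagged_partition \<eta> a b n x s"
      using p t(1) s(1) unfolding tagged_partition_def by auto
    \<comment> \<open>Taking the least index skips degenerate cells and finds the cell with
      \<open>u\<close> in its interior. At division points \<open>step\<close> copies
      \<open>f\<close>, so the squeeze holds there trivially.\<close>
    define idx where "idx u = (LEAST i. u < x (Suc i))" for u
    define step where "step v u = (if u \<in> x ` {..n} then f u else v (idx u))" for v u
    have idx: "idx u = i" "u \<notin> x ` {..n}" if "i < n" "x i < u" "u < x (Suc i)" for i u
    proof -
      show "idx u = i" unfolding idx_def
      proof (rule Least_equality)
        fix j assume "u < x (Suc j)"
        then show "i \<le> j"
          using tagged_partition_mono_points[OF p, of "Suc j" i] that by (force simp: not_le[symmetric])
      qed (use that in auto)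
      show "u \<notin> x ` {..n}"
      proof
        assume "u \<in> x ` {..n}"
        then obtain j where j: "j \<le> n" "u = x j" by auto
        then show False
          using tagged_partition_mono_points[OF p, of j i]
            tagged_partition_mono_points[OF p, of "Suc i" j] that
          by (cases "j \<le> i") auto
      qed
    qed
    have int: "(step v has_integral (\<Sum>i<n. v i * (x (Suc i) - x i))) (cbox a b)" for v
      using has_integral_step_function[of n x "step v" v] le idx ends
      by (auto simp: step_def)
    have bnd: "step (\<lambda>i. f (s i) - \<kappa>) u \<le> f u \<and> f u \<le> step (\<lambda>i. f (t i) + \<kappa>) u"
      if u: "u \<in> cbox a b" for u
    proof (cases "u \<in> x ` {..n}")
      case True
      then show ?thesis by (simp add: step_def)
    next
      case False
      then have "n > 0" using u ends by (auto intro!: gr0I)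
      then obtain i where i: "i < n" "x i \<le> u" "u \<le> x (Suc i)"
        using ex_cell_containing[of x u n] u ends by auto
      moreover have "x i \<in> x ` {..n}" "x (Suc i) \<in> x ` {..n}" using i(1) by auto
      ultimately have "x i < u" "u < x (Suc i)" using False by (metis order_le_less)+
      then have "idx u = i" using idx i by auto
      then show ?thesis using False i t(2)[of i u] s(2)[of i u] by (simp add: step_def)
    qed
    have tel: "(\<Sum>i<n. x (Suc i) - x i) = b - a"
      using sum_lessThan_telescope[of x n] ends by simp
    have "(\<Sum>i<n. (f (t i) + \<kappa>) * (x (Suc i) - x i)) - (\<Sum>i<n. (f (s i) - \<kappa>) * (x (Suc i) - x i))
      = (\<Sum>i<n. (f (t i) - f (s i)) * (x (Suc i) - x i)) + 2 * \<kappa> * (b - a)"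
      unfolding tel[symmetric] sum_distrib_left
      by (simp add: algebra_simps flip: sum_subtractf sum.distrib)
    moreover have "\<bar>\<Sum>i<n. (f (t i) - f (s i)) * (x (Suc i) - x i)\<bar> < e / 2"
    proof -
      have "\<bar>\<Sum>i<n. (f (t i) - f (s i)) * (x (Suc i) - x i)\<bar>
         \<le> (\<Sum>i<n. \<bar>(f (t i) - f (s i)) * (x (Suc i) - x i)\<bar>)" by (rule sum_abs)
      also have "\<dots> = (\<Sum>i<n. norm (f (t i) - f (s i)) * (x (Suc i) - x i))"
        using le by (intro sum.cong) (auto simp: abs_mult)
      also have "\<dots> < e / 2" by (rule \<eta>(2)[OF pt])
      finally show ?thesis .
    qed
    moreover have "2 * \<kappa> * (b - a) < e / 2" "2 * \<kappa> * (b - a) \<ge> 0"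
      using e assms(2) unfolding \<kappa>_def by (auto simp: field_simps)
    ultimately have "\<bar>(\<Sum>i<n. (f (s i) - \<kappa>) * (x (Suc i) - x i)) -
        (\<Sum>i<n. (f (t i) + \<kappa>) * (x (Suc i) - x i))\<bar> < e" by linarith
    then show "\<exists>g h i j. (g has_integral i) (cbox a b) \<and> (h has_integral j) (cbox a b) \<and>
                 \<bar>i - j\<bar> < e \<and> (\<forall>u\<in>cbox a b. g u \<le> f u \<and> f u \<le> h u)"
      by (intro exI[of _ "step (\<lambda>i. f (s i) - \<kappa>)"] exI[of _ "step (\<lambda>i. f (t i) + \<kappa>)"] exI conjI ballI)
        (rule int, rule int, assumption, use bnd in blast, use bnd in blast)
  qed
  then show ?thesis by simp
qed

lemma osc_null_norm_le:
  assumes "osc_null f a b" "\<And>u v. norm (g u - g v) \<le> norm (f u - f v)"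
  shows "osc_null g a b"
  unfolding osc_null_def
proof (intro allI impI)
  fix \<epsilon> :: real assume "\<epsilon> > 0"
  then obtain \<eta> where \<eta>: "\<eta> > 0" "\<And>n x t s. tagged_partition \<eta> a b n x t \<Longrightarrow>
     tagged_partition \<eta> a b n x s \<Longrightarrow> (\<Sum>i<n. norm (f (t i) - f (s i)) * (x (Suc i) - x i)) < \<epsilon>"
    using osc_nullD[OF assms(1)] by blast
  have "(\<Sum>i<n. norm (g (t i) - g (s i)) * (x (Suc i) - x i)) < \<epsilon>"
    if p: "tagged_partition \<eta> a b n x t" "tagged_partition \<eta> a b n x s" for n x t s
  proof -
    have "(\<Sum>i<n. norm (g (t i) - g (s i)) * (x (Suc i) - x i))
       \<le> (\<Sum>i<n. norm (f (t i) - f (s i)) * (x (Suc i) - x i))"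
      using tagged_partition_le_Suc[OF p(1)] assms(2) by (intro sum_mono mult_right_mono) auto
    then show ?thesis using \<eta>(2)[OF p] by linarith
  qed
  then show "\<exists>\<eta>>0. \<forall>n x t s. tagged_partition \<eta> a b n x t \<longrightarrow> tagged_partition \<eta> a b n x s \<longrightarrow>
     (\<Sum>i<n. norm (g (t i) - g (s i)) * (x (Suc i) - x i)) < \<epsilon>" using \<eta>(1) by blast
qed

text \<open>Absolute integrability is the form that survives multiplication by a continuous kernel,
  as the Fourier integrals require.\<close>

lemma osc_null_absolutely_integrable:
  fixes f :: "real \<Rightarrow> complex"
  assumes osc: "osc_null f a b" and "a \<le> b"
  shows "f absolutely_integrable_on {a..b}"
proof -
  obtain B where B: "\<And>u. u \<in> {a..b} \<Longrightarrow> norm (f u) \<le> B" using osc_null_bounded[OF osc] by blast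
  have "(\<lambda>u. Re (f u)) integrable_on {a..b}"
    by (rule osc_null_integrable_real[OF osc_null_norm_le[OF osc] assms(2)])
       (metis abs_Re_le_cmod minus_complex.sel(1) real_norm_def)
  moreover have "(\<lambda>u. Im (f u)) integrable_on {a..b}"
    by (rule osc_null_integrable_real[OF osc_null_norm_le[OF osc] assms(2)])
       (metis abs_Im_le_cmod minus_complex.sel(2) real_norm_def)
  ultimately have "f integrable_on {a..b}"
    by (subst integrable_componentwise_iff) (auto simp: Basis_complex_def)
  then show ?thesis
    by (rule absolutely_integrable_integrable_bound[of _ _ "\<lambda>_. B", rotated])
       (use B integrable_const_ivl in auto)
qed

section \<open>Riemann--Stieltjes integrals\<close>

lemma has_rs_integral_cong:
  assumes "\<And>u. u \<in> {a..b} \<Longrightarrow> g u = g' u"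
  shows "has_rs_integral g f a b I \<longleftrightarrow> has_rs_integral g' f a b I"
proof -
  have "(\<Sum>i<n. g (t i) * (f (x (Suc i)) - f (x i))) = (\<Sum>i<n. g' (t i) * (f (x (Suc i)) - f (x i)))"
    if "tagged_partition \<eta> a b n x t" for \<eta> n x t
    using tagged_partition_tags[OF that] assms by (intro sum.cong) auto
  then show ?thesis unfolding has_rs_integral_def by (simp cong: imp_cong)
qed

lemma has_rs_integral_diff:
  assumes "has_rs_integral g f a b I" "has_rs_integral h f a b J"
  shows "has_rs_integral (\<lambda>u. g u - h u) f a b (I - J)"
  unfolding has_rs_integral_def
proof (intro allI impI)
  fix \<epsilon> :: real assume "\<epsilon> > 0"
  then have e: "\<epsilon> / 2 > 0" by simp
  obtain \<eta>1 where 1: "\<eta>1 > 0" "\<And>n x t. tagged_partition \<eta>1 a b n x t \<Longrightarrow>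
     norm ((\<Sum>i<n. g (t i) * (f (x (Suc i)) - f (x i))) - I) < \<epsilon> / 2"
    using has_rs_integralD[OF assms(1) e] by blast
  obtain \<eta>2 where 2: "\<eta>2 > 0" "\<And>n x t. tagged_partition \<eta>2 a b n x t \<Longrightarrow>
     norm ((\<Sum>i<n. h (t i) * (f (x (Suc i)) - f (x i))) - J) < \<epsilon> / 2"
    using has_rs_integralD[OF assms(2) e] by blast
  have "norm ((\<Sum>i<n. (g (t i) - h (t i)) * (f (x (Suc i)) - f (x i))) - (I - J)) < \<epsilon>"
    if p: "tagged_partition (min \<eta>1 \<eta>2) a b n x t" for n x t
  proof -
    let ?G = "(\<Sum>i<n. g (t i) * (f (x (Suc i)) - f (x i))) - I"
    let ?H = "(\<Sum>i<n. h (t i) * (f (x (Suc i)) - f (x i))) - J"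
    have e: "(\<Sum>i<n. (g (t i) - h (t i)) * (f (x (Suc i)) - f (x i))) - (I - J) = ?G - ?H"
      by (simp add: left_diff_distrib sum_subtractf)
    have "norm (?G - ?H) \<le> norm ?G + norm ?H" by (rule norm_triangle_ineq4)
    moreover have "norm ?G < \<epsilon> / 2" "norm ?H < \<epsilon> / 2"
      by (rule 1(2) 2(2), rule tagged_partition_mono[OF p], simp)+
    ultimately show ?thesis unfolding e by linarith
  qed
  then show "\<exists>\<eta>>0. \<forall>n x t. tagged_partition \<eta> a b n x t \<longrightarrow>
     norm ((\<Sum>i<n. (g (t i) - h (t i)) * (f (x (Suc i)) - f (x i))) - (I - J)) < \<epsilon>"
    using 1(1) 2(1) by (intro exI[of _ "min \<eta>1 \<eta>2"]) auto
qed

text \<open>Abel summation for interlaced sequences: \<open>f i\<close> sits between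
  \<open>g i\<close> and \<open>g (Suc i)\<close>, so the sum on the right has one term more. In the
  application \<open>g\<close> runs through the tags framed by the two endpoints.\<close>

lemma sum_by_parts:
  fixes f g :: "nat \<Rightarrow> 'a::comm_ring"
  shows "(\<Sum>i<n. g (Suc i) * (f (Suc i) - f i)) =
    f n * g (Suc n) - f 0 * g 0 - (\<Sum>i<Suc n. f i * (g (Suc i) - g i))"
  by (induction n) (auto simp: algebra_simps)

text \<open>The tags of a partition, together with the endpoints, form a partition whose tags are the
  division points of the original one.\<close>

lemma has_rs_integral_by_parts:
  fixes f g :: "real \<Rightarrow> 'a::real_normed_field"
  assumes "has_rs_integral f g a b I"
  shows "has_rs_integral g f a b (f b * g b - f a * g a - I)"
  unfolding has_rs_integral_def
proof (intro allI impI)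
  fix \<epsilon> :: real assume "\<epsilon> > 0"
  then obtain \<eta> where \<eta>: "\<eta> > 0" "\<And>n x t. tagged_partition \<eta> a b n x t \<Longrightarrow>
     norm ((\<Sum>i<n. f (t i) * (g (x (Suc i)) - g (x i))) - I) < \<epsilon>"
    using has_rs_integralD[OF assms] by blast
  \<comment> \<open>A cell of the new partition joins consecutive tags and may stretch over two old
    cells, hence the mesh \<open>\<eta> / 2\<close>.\<close>
  have "norm ((\<Sum>i<n. g (t i) * (f (x (Suc i)) - f (x i))) - (f b * g b - f a * g a - I)) < \<epsilon>"
    if p: "tagged_partition (\<eta> / 2) a b n x t" for n x t
  proof -
    have ends: "x 0 = a" "x n = b"
      and cell: "\<And>i. i < n \<Longrightarrow> x i \<le> t i \<and> t i \<le> x (Suc i) \<and> x (Suc i) - x i < \<eta> / 2"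
      using p unfolding tagged_partition_def by auto
    define y where "y i = (if i = 0 then a else if i \<le> n then t (i - 1) else b)" for i
    have y: "y 0 = a" "y (Suc n) = b" "\<And>i. i < n \<Longrightarrow> y (Suc i) = t i" unfolding y_def by auto
    have lo: "y i \<le> x i \<and> x i - y i < \<eta> / 2" if "i \<le> n" for i
      using cell[of "i - 1"] that ends \<eta>(1) unfolding y_def by (cases i) auto
    have hi: "x i \<le> y (Suc i) \<and> y (Suc i) - x i < \<eta> / 2" if "i \<le> n" for i
      using cell[of i] that ends \<eta>(1) unfolding y_def by (cases "i = n") auto
    have q: "tagged_partition \<eta> a b (Suc n) y x"
      unfolding tagged_partition_def
    proof (intro conjI allI impI)
      fix i assume "i < Suc n"
      then show "y i \<le> x i" "x i \<le> y (Suc i)" "y (Suc i) - y i < \<eta>"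
        using lo[of i] hi[of i] by auto
    qed (use y in auto)
    have "(\<Sum>i<n. g (t i) * (f (x (Suc i)) - f (x i)))
       = (\<Sum>i<n. g (y (Suc i)) * (f (x (Suc i)) - f (x i)))"
      using y(3) by (intro sum.cong) auto
    also have "\<dots> = f b * g b - f a * g a - (\<Sum>i<Suc n. f (x i) * (g (y (Suc i)) - g (y i)))"
      using sum_by_parts[of "\<lambda>i. g (y i)" "\<lambda>i. f (x i)" n] y(1,2) ends by simp
    finally have "(\<Sum>i<n. g (t i) * (f (x (Suc i)) - f (x i))) - (f b * g b - f a * g a - I)
       = - ((\<Sum>i<Suc n. f (x i) * (g (y (Suc i)) - g (y i))) - I)" by simp
    then show ?thesis using \<eta>(2)[OF q] by (metis norm_minus_cancel)
  qed
  then show "\<exists>\<eta>>0. \<forall>n x t. tagged_partition \<eta> a b n x t \<longrightarrow>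
     norm ((\<Sum>i<n. g (t i) * (f (x (Suc i)) - f (x i))) - (f b * g b - f a * g a - I)) < \<epsilon>"
    using \<eta>(1) by (intro exI[of _ "\<eta> / 2"]) auto
qed

lemma tagged_partition_tags_mono:
  assumes "tagged_partition \<eta> a b n x t" "i \<le> j" "j < n"
  shows "t i \<le> t j"
proof (cases "i = j")
  case False
  then have "x (Suc i) \<le> x j"
    using tagged_partition_mono_points[OF assms(1), of "Suc i" j] assms by auto
  moreover have "t i \<le> x (Suc i)" "x j \<le> t j"
    using assms unfolding tagged_partition_def by auto
  ultimately show ?thesis by simp
qed simp

text \<open>The sum telescopes from the first cell whose tag satisfies \<open>P\<close>, and that
  cell starts near \<open>p\<close>; continuity of \<open>f\<close> at \<open>p\<close> finishes.
  Leaving \<open>P p\<close> open covers both conventions, \<open>p \<le> u\<close> and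
  \<open>p < u\<close>.\<close>

lemma has_rs_integral_jump:
  fixes f :: "real \<Rightarrow> 'a::real_normed_field"
  assumes p: "p \<in> {a..b}" and f: "continuous (at p within {a..b}) f"
    and P: "\<And>u. u < p \<Longrightarrow> \<not> P u" "\<And>u. u > p \<Longrightarrow> P u"
  shows "has_rs_integral (\<lambda>u. if P u then 1 else 0) f a b (f b - f p)"
  unfolding has_rs_integral_def
proof (intro allI impI)
  fix \<epsilon> :: real assume "\<epsilon> > 0"
  then obtain \<eta> where \<eta>: "\<eta> > 0" "\<And>u. u \<in> {a..b} \<Longrightarrow> dist u p < \<eta> \<Longrightarrow> dist (f u) (f p) < \<epsilon>"
    using f unfolding continuous_within_eps_delta by blast
  have "norm ((\<Sum>i<n. (if P (t i) then 1 else 0) * (f (x (Suc i)) - f (x i))) - (f b - f p)) < \<epsilon>"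
    if q: "tagged_partition \<eta> a b n x t" for n x t
  proof -
    have ends: "x 0 = a" "x n = b"
      and cell: "\<And>i. i < n \<Longrightarrow> x i \<le> t i \<and> t i \<le> x (Suc i) \<and> x (Suc i) - x i < \<eta>"
      using q unfolding tagged_partition_def by auto
    \<comment> \<open>The default \<open>n\<close> stands for the case that no tag satisfies
      \<open>P\<close>; the telescoping sum is then empty and \<open>x k = b\<close>.\<close>
    define k where "k = (LEAST i. i = n \<or> P (t i))"
    have k: "k = n \<or> P (t k)" unfolding k_def by (rule LeastI[of _ n]) simp
    have kn: "k \<le> n" unfolding k_def by (rule Least_le) simp
    have below: "\<not> P (t i)" if "i < k" for i using not_less_Least that unfolding k_def by blast
    have above: "P (t i)" if i: "k \<le> i" "i < n" for i
    proof (cases "t i = t k")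
      case True
      then show ?thesis using k i by auto
    next
      case False
      then have "t k < t i" using tagged_partition_tags_mono[OF q i] by simp
      moreover have "p \<le> t k" using k i P(1)[of "t k"] by force
      ultimately show ?thesis using P(2) by simp
    qed
    have "(\<Sum>i<n. (if P (t i) then 1 else 0) * (f (x (Suc i)) - f (x i)))
       = (\<Sum>i\<in>{k..<n}. f (x (Suc i)) - f (x i))"
      by (rule sum.mono_neutral_cong_right) (use below above in auto)
    also have "\<dots> = f b - f (x k)" using sum_Suc_diff'[OF kn, of "\<lambda>i. f (x i)"] ends by simp
    finally have e: "(\<Sum>i<n. (if P (t i) then 1 else 0) * (f (x (Suc i)) - f (x i))) - (f b - f p)
       = - (f (x k) - f p)" by simp
    \<comment> \<open>\<open>x k\<close> and \<open>p\<close> share a cell: if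
      \<open>x k \<le> p\<close> then \<open>p \<le> t k\<close> (or \<open>x k = p = b\<close>),
      and otherwise the previous tag is at most \<open>p\<close>.\<close>
    have "\<bar>x k - p\<bar> < \<eta>"
    proof (cases "x k \<le> p")
      case True
      show ?thesis
      proof (cases "k = n")
        case False
        then have "p \<le> t k" "k < n" using k kn P(1)[of "t k"] by force+
        then show ?thesis using cell[of k] True by auto
      qed (use True ends p \<eta>(1) in auto)
    next
      case False
      then have "k > 0" using ends p by (auto intro!: gr0I)
      then have "t (k - 1) \<le> p" using below[of "k - 1"] P(2)[of "t (k - 1)"] by force
      moreover have "k - 1 < n" "Suc (k - 1) = k" using \<open>k > 0\<close> kn by auto
      ultimately show ?thesis using cell[of "k - 1"] False by auto
    qed
    then show ?thesis unfolding e norm_minus_cancel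
      using \<eta>(2)[of "x k"] tagged_partition_points[OF q kn] by (simp add: dist_norm)
  qed
  then show "\<exists>\<eta>>0. \<forall>n x t. tagged_partition \<eta> a b n x t \<longrightarrow>
     norm ((\<Sum>i<n. (if P (t i) then 1 else 0) * (f (x (Suc i)) - f (x i))) - (f b - f p)) < \<epsilon>"
    using \<eta>(1) by blast
qed

section \<open>Stieltjes integrals against continuously differentiable integrators\<close>

lemma integral_partition:
  fixes g :: "real \<Rightarrow> complex"
  assumes p: "tagged_partition \<eta> a b n x t" and g: "g integrable_on {a..b}"
  shows "integral {a..b} g = (\<Sum>i<n. integral {x i..x (Suc i)} g)"
proof -
  have "integral {x 0..x m} g = (\<Sum>i<m. integral {x i..x (Suc i)} g)" if "m \<le> n" for m
    using that
  proof (induction m)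
    case (Suc m)
    have "g integrable_on {x 0..x (Suc m)}"
      by (rule integrable_subinterval_real[OF g])
        (use tagged_partition_points[OF p] Suc.prems in force)
    then have "integral {x 0..x m} g + integral {x m..x (Suc m)} g = integral {x 0..x (Suc m)} g"
      by (intro Henstock_Kurzweil_Integration.integral_combine)
        (use tagged_partition_mono_points[OF p] Suc.prems in auto)
    then show ?case using Suc by simp
  qed simp
  from this[of n] show ?thesis using p unfolding tagged_partition_def by simp
qed

lemma absolutely_integrable_mult_continuous:
  fixes f g :: "real \<Rightarrow> complex"
  assumes "f absolutely_integrable_on {a..b}" "continuous_on {a..b} g"
  shows "(\<lambda>u. f u * g u) absolutely_integrable_on {a..b}"
proof -
  have "(\<lambda>u. g u * f u) absolutely_integrable_on {a..b}"
  proof (rule absolutely_integrable_bounded_measurable_product[OF bilinear_conv_bounded_bilinear[THEN iffD2, OF bounded_bilinear_mult]])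
    show "g \<in> borel_measurable (lebesgue_on {a..b})"
      by (rule continuous_imp_measurable_on_sets_lebesgue[OF assms(2)]) simp
    show "bounded (g ` {a..b})"
      using assms(2) compact_continuous_image compact_imp_bounded by blast
  qed (use assms in auto)
  then show ?thesis by (simp add: mult.commute)
qed

text \<open>On a cell, \<open>f (t i)\<close> times the increment of \<open>\<phi>\<close> is the
  integral of the constant \<open>f (t i)\<close> against \<open>\<phi>'\<close>. The error is
  therefore at most a bound for \<open>\<phi>'\<close> times the oscillation of \<open>f\<close>,
  and \<open>osc_null\<close> makes the total small.\<close>

lemma osc_null_has_rs_integral:
  fixes f \<phi> \<phi>' :: "real \<Rightarrow> complex"
  assumes osc: "osc_null f a b" and "a \<le> b"
    and \<phi>: "\<And>u. u \<in> {a..b} \<Longrightarrow> (\<phi> has_vector_derivative \<phi>' u) (at u within {a..b})"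
    and cont: "continuous_on {a..b} \<phi>'"
  shows "has_rs_integral f \<phi> a b (integral {a..b} (\<lambda>u. f u * \<phi>' u))"
  unfolding has_rs_integral_def
proof (intro allI impI)
  fix \<epsilon> :: real assume \<epsilon>: "\<epsilon> > 0"
  obtain M where M: "M > 0" "\<And>u. u \<in> {a..b} \<Longrightarrow> norm (f u) \<le> M" using osc_null_bounded[OF osc] by blast
  have "bounded (\<phi>' ` {a..b})" using cont compact_continuous_image compact_imp_bounded by blast
  then obtain B where B: "B > 0" "\<And>u. u \<in> {a..b} \<Longrightarrow> norm (\<phi>' u) \<le> B"
    unfolding bounded_pos by auto
  have int: "(\<lambda>u. f u * \<phi>' u) integrable_on {a..b}"
    using absolutely_integrable_mult_continuous[OF osc_null_absolutely_integrable[OF osc assms(2)] cont]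
    by (rule set_lebesgue_integral_eq_integral(1))
  obtain \<eta> where \<eta>: "\<eta> > 0" "\<And>n x t s. tagged_partition \<eta> a b n x t \<Longrightarrow>
     tagged_partition \<eta> a b n x s \<Longrightarrow>
     (\<Sum>i<n. norm (f (t i) - f (s i)) * (x (Suc i) - x i)) < \<epsilon> / (2 * B)"
    using osc_nullD[OF osc, of "\<epsilon> / (2 * B)"] \<epsilon> B(1) by auto
  define \<kappa> where "\<kappa> = \<epsilon> / (2 * B * (b - a + 1))"
  have \<kappa>: "\<kappa> > 0" using \<epsilon> B(1) assms(2) unfolding \<kappa>_def by auto
  have "norm ((\<Sum>i<n. f (t i) * (\<phi> (x (Suc i)) - \<phi> (x i))) - integral {a..b} (\<lambda>u. f u * \<phi>' u)) < \<epsilon>"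
    if p: "tagged_partition \<eta> a b n x t" for n x t
  proof -
    have ends: "x 0 = a" "x n = b" using p unfolding tagged_partition_def by auto
    have le: "x i \<le> x (Suc i)" if "i < n" for i using tagged_partition_le_Suc[OF p that] .
    have sub: "{x i..x (Suc i)} \<subseteq> {a..b}" if "i < n" for i
      using tagged_partition_points[OF p, of i] tagged_partition_points[OF p, of "Suc i"] that by auto
    \<comment> \<open>\<open>s i\<close> is a point where \<open>f\<close> is, up to \<kappa>,
      farthest from \<open>f (t i)\<close>. The pair \<open>t\<close>, \<open>s\<close> then turns a
      pointwise estimate on each cell into an oscillation sum between two taggings.\<close>
    have "\<exists>s. s \<in> {x i..x (Suc i)} \<and> (\<forall>u\<in>{x i..x (Suc i)}. norm (f (t i) - f u) \<le> norm (f (t i) - f s) + \<kappa>)"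
      if i: "i < n" for i
    proof (rule bounded_near_maximum[of "{x i..x (Suc i)}" "\<lambda>u. norm (f (t i) - f u)" "2 * M" \<kappa>])
      show "norm (f (t i) - f u) \<le> 2 * M" if "u \<in> {x i..x (Suc i)}" for u
        using norm_triangle_ineq4[of "f (t i)" "f u"] M(2)[OF tagged_partition_tags[OF p i]]
          M(2)[of u] sub[OF i] that by auto
    qed (use le[OF i] \<kappa> in auto)
    then obtain s where s: "\<And>i. i < n \<Longrightarrow> s i \<in> {x i..x (Suc i)}"
        "\<And>i u. i < n \<Longrightarrow> u \<in> {x i..x (Suc i)} \<Longrightarrow> norm (f (t i) - f u) \<le> norm (f (t i) - f (s i)) + \<kappa>"
      by metis
    have ps: "tagged_partition \<eta> a b n x s" using p s(1) unfolding tagged_partition_def by auto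
    have cell: "norm (f (t i) * (\<phi> (x (Suc i)) - \<phi> (x i)) - integral {x i..x (Suc i)} (\<lambda>u. f u * \<phi>' u))
       \<le> B * ((norm (f (t i) - f (s i)) + \<kappa>) * (x (Suc i) - x i))" if i: "i < n" for i
    proof -
      have "(\<phi>' has_integral \<phi> (x (Suc i)) - \<phi> (x i)) {x i..x (Suc i)}"
      proof (rule fundamental_theorem_of_calculus[OF le[OF i]])
        show "(\<phi> has_vector_derivative \<phi>' u) (at u within {x i..x (Suc i)})" if "u \<in> {x i..x (Suc i)}" for u
          using \<phi>[of u] that sub[OF i] has_vector_derivative_within_subset by blast
      qed
      then have 1: "((\<lambda>u. f (t i) * \<phi>' u) has_integral f (t i) * (\<phi> (x (Suc i)) - \<phi> (x i))) {x i..x (Suc i)}"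
        by (rule has_integral_mult_right)
      have 2: "((\<lambda>u. f u * \<phi>' u) has_integral integral {x i..x (Suc i)} (\<lambda>u. f u * \<phi>' u)) {x i..x (Suc i)}"
        using integrable_subinterval_real[OF int sub[OF i]] by (rule integrable_integral)
      have "norm (f (t i) * (\<phi> (x (Suc i)) - \<phi> (x i)) - integral {x i..x (Suc i)} (\<lambda>u. f u * \<phi>' u))
        \<le> (norm (f (t i) - f (s i)) + \<kappa>) * B * measure lborel (cbox (x i) (x (Suc i)))"
      proof (rule has_integral_bound)
        show "((\<lambda>u. f (t i) * \<phi>' u - f u * \<phi>' u) has_integral
            f (t i) * (\<phi> (x (Suc i)) - \<phi> (x i)) - integral {x i..x (Suc i)} (\<lambda>u. f u * \<phi>' u))
            (cbox (x i) (x (Suc i)))"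
          using has_integral_diff[OF 1 2] by simp
        fix u assume u: "u \<in> cbox (x i) (x (Suc i))"
        have "norm (f (t i) * \<phi>' u - f u * \<phi>' u) = norm (f (t i) - f u) * norm (\<phi>' u)"
          by (simp flip: norm_mult add: left_diff_distrib)
        also have "\<dots> \<le> (norm (f (t i) - f (s i)) + \<kappa>) * B"
          using u s(2)[OF i, of u] B(2)[of u] sub[OF i] \<kappa> by (intro mult_mono) auto
        finally show "norm (f (t i) * \<phi>' u - f u * \<phi>' u) \<le> (norm (f (t i) - f (s i)) + \<kappa>) * B" .
      qed (use B(1) \<kappa> in auto)
      then show ?thesis using le[OF i] by (simp add: mult_ac)
    qed
    have "norm ((\<Sum>i<n. f (t i) * (\<phi> (x (Suc i)) - \<phi> (x i))) - integral {a..b} (\<lambda>u. f u * \<phi>' u))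
      = norm (\<Sum>i<n. f (t i) * (\<phi> (x (Suc i)) - \<phi> (x i)) - integral {x i..x (Suc i)} (\<lambda>u. f u * \<phi>' u))"
      unfolding integral_partition[OF p int] by (simp add: sum_subtractf)
    also have "\<dots> \<le> (\<Sum>i<n. B * ((norm (f (t i) - f (s i)) + \<kappa>) * (x (Suc i) - x i)))"
      using cell by (intro sum_norm_le) auto
    also have "\<dots> = B * (\<Sum>i<n. norm (f (t i) - f (s i)) * (x (Suc i) - x i))
        + B * \<kappa> * (\<Sum>i<n. x (Suc i) - x i)"
      by (simp add: sum_distrib_left distrib_right distrib_left sum.distrib mult.assoc)
    also have "(\<Sum>i<n. x (Suc i) - x i) = b - a"
      using sum_lessThan_telescope[of x n] ends by simp
    also have "B * \<kappa> * (b - a) < \<epsilon> / 2"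
    proof -
      have "B * \<kappa> * (b - a) = \<epsilon> / 2 * ((b - a) / (b - a + 1))" using B(1) by (simp add: \<kappa>_def)
      also have "\<dots> < \<epsilon> / 2 * 1" using \<epsilon> assms(2) by (intro mult_strict_left_mono) auto
      finally show ?thesis by simp
    qed
    also have "B * (\<Sum>i<n. norm (f (t i) - f (s i)) * (x (Suc i) - x i)) < \<epsilon> / 2"
      using \<eta>(2)[OF p ps] B(1) by (simp add: field_simps)
    finally show ?thesis by simp
  qed
  then show "\<exists>\<eta>>0. \<forall>n x t. tagged_partition \<eta> a b n x t \<longrightarrow>
     norm ((\<Sum>i<n. f (t i) * (\<phi> (x (Suc i)) - \<phi> (x i))) - integral {a..b} (\<lambda>u. f u * \<phi>' u)) < \<epsilon>"
    using \<eta>(1) by blast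
qed

section \<open>The sawtooth series and Cesaro means\<close>

definition dirichlet_kernel :: "nat \<Rightarrow> real \<Rightarrow> real" where
  "dirichlet_kernel l w = 1 + 2 * (\<Sum>n=1..l. cos (2 * pi * real n * w))"

text \<open>The symmetric partial sum of the series for \<open>- psi\<close>, with the terms for
  \<open>n\<close> and \<open>- n\<close> paired into a real sine.\<close>

definition sawtooth_sum :: "nat \<Rightarrow> real \<Rightarrow> real" where
  "sawtooth_sum l w = (\<Sum>n=1..l. sin (2 * pi * real n * w) / (pi * real n))"

lemma dirichlet_kernel_sin:
  "dirichlet_kernel l w * sin (pi * w) = sin ((2 * real l + 1) * (pi * w))"
proof (induction l)
  case (Suc l)
  have "2 * cos (2 * pi * real (Suc l) * w) * sin (pi * w)
      = sin ((2 * real (Suc l) + 1) * (pi * w)) - sin ((2 * real l + 1) * (pi * w))"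
  proof -
    define x y where "x = 2 * pi * real (Suc l) * w" and "y = pi * w"
    have "2 * cos x * sin y = sin (x + y) - sin (x - y)" by (simp add: sin_add sin_diff)
    then show ?thesis unfolding x_def y_def by (simp add: algebra_simps)
  qed
  then show ?case using Suc by (simp add: dirichlet_kernel_def algebra_simps)
qed (simp add: dirichlet_kernel_def)

text \<open>With the second factor \<open>sin (pi * w)\<close> each summand becomes a difference of
  consecutive squares, by sin(x+y) sin(x-y) = sin^2 x - sin^2 y, and the sum telescopes to an
  unnormalised Fejer kernel.\<close>

lemma fejer_sum_sin:
  "(\<Sum>l\<le>N. dirichlet_kernel l w) * (sin (pi * w))\<^sup>2 = (sin ((real N + 1) * (pi * w)))\<^sup>2"
proof (induction N)
  case 0
  then show ?case by (simp add: dirichlet_kernel_def)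
next
  case (Suc N)
  have "dirichlet_kernel (Suc N) w * (sin (pi * w))\<^sup>2
     = sin ((2 * real (Suc N) + 1) * (pi * w)) * sin (pi * w)"
    using dirichlet_kernel_sin[of "Suc N" w] by (simp add: power2_eq_square)
  also have "\<dots> = (sin ((real (Suc N) + 1) * (pi * w)))\<^sup>2 - (sin ((real N + 1) * (pi * w)))\<^sup>2"
  proof -
    define x y where "x = (real N + 2) * (pi * w)" and "y = (real N + 1) * (pi * w)"
    have "sin (x + y) * sin (x - y) = (sin x * cos y)\<^sup>2 - (cos x * sin y)\<^sup>2"
      by (simp add: sin_add sin_diff power2_eq_square algebra_simps)
    also have "\<dots> = (sin x)\<^sup>2 - (sin y)\<^sup>2"
      by (simp add: cos_squared_eq power_mult_distrib algebra_simps)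
    finally show ?thesis unfolding x_def y_def by (simp add: algebra_simps)
  qed
  finally show ?case using Suc by (simp add: distrib_right)
qed

lemma fejer_sum_nonneg: "(\<Sum>l\<le>N. dirichlet_kernel l w) \<ge> 0"
proof (cases "sin (pi * w) = 0")
  case True
  \<comment> \<open>The closed formula says nothing where the sine vanishes; there every cosine
    equals 1, so every Dirichlet kernel is positive.\<close>
  have "cos (2 * pi * real n * w) = 1" for n
  proof -
    have "sin (real n * (pi * w)) = 0"
      using True by (induction n) (auto simp: distrib_right sin_add)
    then show ?thesis using cos_double_sin[of "real n * (pi * w)"] by (simp add: mult_ac)
  qed
  then show ?thesis unfolding dirichlet_kernel_def by (intro sum_nonneg) auto
next
  case False
  then have "(sin (pi * w))\<^sup>2 > 0" by simp
  then show ?thesis using fejer_sum_sin[of w N] by (metis zero_le_mult_iff zero_le_power2 not_less)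
qed

text \<open>The bound is independent of \<open>N\<close>, so away from integers the kernel
  disappears after division by \<open>N\<close>.\<close>

lemma fejer_sum_le:
  assumes "sin (pi * w) \<noteq> 0"
  shows "(\<Sum>l\<le>N. dirichlet_kernel l w) \<le> 1 / (sin (pi * w))\<^sup>2"
proof -
  have "(sin ((real N + 1) * (pi * w)))\<^sup>2 \<le> 1" by (simp add: abs_square_le_1)
  then have "(\<Sum>l\<le>N. dirichlet_kernel l w) * (sin (pi * w))\<^sup>2 \<le> 1" by (simp add: fejer_sum_sin)
  moreover have "(sin (pi * w))\<^sup>2 > 0" using assms by simp
  ultimately show ?thesis by (simp add: pos_le_divide_eq)
qed

lemma sawtooth_sum_has_derivative:
  "(sawtooth_sum l has_real_derivative dirichlet_kernel l w - 1) (at w within S)"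
proof -
  have "((\<lambda>w. \<Sum>n=1..l. sin (2 * pi * real n * w) / (pi * real n)) has_real_derivative
     (\<Sum>n=1..l. 2 * cos (2 * pi * real n * w))) (at w within S)"
    by (rule DERIV_sum) (auto intro!: derivative_eq_intros simp: field_simps)
  then show ?thesis by (simp add: sawtooth_sum_def[abs_def] dirichlet_kernel_def sum_distrib_left)
qed

text \<open>The difference between the partial sum and its limit has derivative
  \<open>sin ((2 l + 1) \<pi> w) / sin (\<pi> w)\<close>. Subtracting an approximate antiderivative \<open>G\<close> of the latter
  leaves a derivative of size \<open>O(1/l)\<close> on compact subintervals of \<open>(0, 1)\<close>, and everything vanishes
  at \<open>1/2\<close>.\<close>

lemma sawtooth_sum_tendsto:
  assumes w: "0 < w" "w < 1"
  shows "(\<lambda>l. sawtooth_sum l w) \<longlonglongrightarrow> 1 / 2 - w"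
proof -
  \<comment> \<open>\<open>{v..1 - v}\<close> is symmetric about 1/2, contains \<open>w\<close>, and
    stays away from the zeros of \<open>sin (pi * s)\<close>; \<open>m\<close> is the minimum of
    that sine on it.\<close>
  define v where "v = min w (1 - w)"
  have v: "0 < v" "v \<le> 1 / 2" using w unfolding v_def by linarith+
  define m where "m = sin (pi * v)"
  have m: "m > 0" unfolding m_def using v by (intro sin_gt_zero) auto
  have mono: "sin (pi * x) \<le> sin (pi * y)" if "0 \<le> x" "x \<le> y" "y \<le> 1 / 2" for x y
  proof (rule sin_monotone_2pi_le)
    have "0 \<le> pi * x" using that(1) by simp
    then show "- (pi / 2) \<le> pi * x" using pi_gt_zero by linarith
  qed (use that in auto)
  have sin_ge: "sin (pi * s) \<ge> m" if "v \<le> s" "s \<le> 1 - v" for s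
  proof (cases "s \<le> 1 / 2")
    case True
    then show ?thesis unfolding m_def using v that by (intro mono) auto
  next
    case False
    have "sin (pi * v) \<le> sin (pi * (1 - s))"
      using v that False by (intro mono) auto
    also have "\<dots> = sin (pi * s)" using sin_pi_minus[of "pi * s"] by (simp add: algebra_simps)
    finally show ?thesis unfolding m_def .
  qed
  have bound: "\<bar>sawtooth_sum l w - (1 / 2 - w)\<bar> \<le> (1 / m\<^sup>2 + 1 / m) / (2 * real l + 1)" for l
  proof -
    define q where "q = 2 * real l + 1"
    have q: "q > 0" unfolding q_def by simp
    \<comment> \<open>The boundary term when \<open>sin (q * (pi * s)) / sin (pi * s)\<close> is
      integrated by parts. What remains is the derivative of \<open>H\<close>, which carries the
      factor 1/q.\<close>
    define G where "G s = - cos (q * (pi * s)) / (q * pi * sin (pi * s))" for s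
    define H where "H s = sawtooth_sum l s + s - 1 / 2 - G s" for s
    have H': "(H has_real_derivative - cos (q * (pi * s)) * cos (pi * s) / (q * (sin (pi * s))\<^sup>2)) (at s within S)"
      if "v \<le> s" "s \<le> 1 - v" for s S
    proof -
      have s: "sin (pi * s) > 0" using sin_ge[OF that] m by simp
      have "dirichlet_kernel l s = sin (q * (pi * s)) / sin (pi * s)"
        using dirichlet_kernel_sin[of l s] s by (simp add: q_def field_simps)
      then have 1: "(sawtooth_sum l has_real_derivative sin (q * (pi * s)) / sin (pi * s) - 1) (at s within S)"
        using sawtooth_sum_has_derivative[of l s S] by simp
      have 2: "(G has_real_derivative
          sin (q * (pi * s)) / sin (pi * s) + cos (q * (pi * s)) * cos (pi * s) / (q * (sin (pi * s))\<^sup>2)) (at s within S)"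
        unfolding G_def using s q
        by (auto intro!: derivative_eq_intros simp: field_simps power2_eq_square)
      show ?thesis unfolding H_def using DERIV_diff[OF DERIV_diff[OF DERIV_add[OF 1 DERIV_ident] DERIV_const] 2]
        by simp
    qed
    have "norm (H w - H (1 / 2)) \<le> 1 / (q * m\<^sup>2) * norm (w - 1 / 2)"
    proof (rule field_differentiable_bound)
      show "convex {v..1 - v}" by simp
      show "(H has_field_derivative - cos (q * (pi * s)) * cos (pi * s) / (q * (sin (pi * s))\<^sup>2)) (at s within {v..1 - v})"
        if "s \<in> {v..1 - v}" for s using H' that by auto
      fix s assume s: "s \<in> {v..1 - v}"
      have "\<bar>cos (q * (pi * s)) * cos (pi * s)\<bar> \<le> 1 * 1"
        unfolding abs_mult by (intro mult_mono) auto
      moreover have "m\<^sup>2 \<le> (sin (pi * s))\<^sup>2" using sin_ge[of s] s m by (intro power_mono) auto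
      ultimately show "norm (- cos (q * (pi * s)) * cos (pi * s) / (q * (sin (pi * s))\<^sup>2)) \<le> 1 / (q * m\<^sup>2)"
        using q m unfolding real_norm_def abs_divide by (intro frac_le) (auto simp: abs_mult)
    qed (use v v_def in auto)
    moreover have "H (1 / 2) = 0"
    proof -
      have "sin (2 * pi * real n * (1 / 2)) = 0" for n
        using sin_npi[of n] by (simp add: mult.commute)
      then have "sawtooth_sum l (1 / 2) = 0" unfolding sawtooth_sum_def by simp
      \<comment> \<open>Here it matters that \<open>q\<close> is odd.\<close>
      moreover have "cos (q * (pi * (1 / 2))) = 0"
      proof -
        have e: "q * (pi * (1 / 2)) = real l * pi + pi / 2" unfolding q_def by (simp add: field_simps)
        show ?thesis unfolding e by (simp add: cos_add)
      qed
      ultimately show ?thesis unfolding H_def G_def by simp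
    qed
    moreover have "1 / (q * m\<^sup>2) * norm (w - 1 / 2) \<le> 1 / (q * m\<^sup>2) * 1"
      using q w by (intro mult_left_mono) auto
    ultimately have 1: "\<bar>H w\<bar> \<le> 1 / (q * m\<^sup>2)" by simp
    have 2: "\<bar>G w\<bar> \<le> 1 / (q * m)"
    proof -
      have "sin (pi * w) \<ge> m" using sin_ge[of w] v_def by auto
      moreover have "pi \<ge> 1" using pi_ge_two by linarith
      ultimately have "q * 1 * m \<le> q * pi * sin (pi * w)" using q m by (intro mult_mono) auto
      then have "q * m \<le> \<bar>q * pi * sin (pi * w)\<bar>" by linarith
      then show ?thesis unfolding G_def abs_divide using q m
        by (intro frac_le) (auto simp del: abs_mult)
    qed
    have "\<bar>sawtooth_sum l w - (1 / 2 - w)\<bar> = \<bar>H w + G w\<bar>" unfolding H_def by simp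
    also have "\<dots> \<le> 1 / (q * m\<^sup>2) + 1 / (q * m)" using 1 2 by linarith
    also have "\<dots> = (1 / m\<^sup>2 + 1 / m) / q" by (simp add: add_divide_distrib mult.commute)
    finally show ?thesis unfolding q_def .
  qed
  have "(\<lambda>l. (1 / m\<^sup>2 + 1 / m) / (2 * real l + 1)) \<longlonglongrightarrow> 0"
    by (intro real_tendsto_divide_at_top[OF tendsto_const]
        filterlim_at_top_mono[OF filterlim_real_sequentially]) auto
  then have "(\<lambda>l. sawtooth_sum l w - (1 / 2 - w)) \<longlonglongrightarrow> 0"
    by (rule Lim_null_comparison[rotated]) (use bound in auto)
  then show ?thesis by (simp add: LIM_zero_iff)
qed

lemma cesaro_mean_tendsto:
  fixes X :: "nat \<Rightarrow> 'a::real_normed_field"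
  assumes "X \<longlonglongrightarrow> L"
  shows "(\<lambda>N. (\<Sum>l=1..N. X l) / of_nat N) \<longlonglongrightarrow> L"
proof (rule LIMSEQ_I)
  fix r :: real assume r: "r > 0"
  obtain M where M: "\<And>l. l \<ge> M \<Longrightarrow> norm (X l - L) < r / 2"
    using LIMSEQ_D[OF assms, of "r / 2"] r by auto
  define K where "K = (\<Sum>l=1..M. norm (X l - L))"
  have K: "K \<ge> 0" unfolding K_def by (intro sum_nonneg) auto
  obtain N0 :: nat where N0: "N0 > 2 * K / r" using reals_Archimedean2 by blast
  show "\<exists>no. \<forall>N\<ge>no. norm ((\<Sum>l=1..N. X l) / of_nat N - L) < r"
  proof (intro exI[of _ "max 1 (max N0 M)"] allI impI)
    fix N assume "N \<ge> max 1 (max N0 M)"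
    then have N: "N \<ge> 1" "N \<ge> N0" "N \<ge> M" by auto
    have "(\<Sum>l=1..N. X l) / of_nat N - L = (\<Sum>l=1..N. X l - L) / of_nat N"
      using N(1) by (simp add: sum_subtractf field_simps)
    then have "norm ((\<Sum>l=1..N. X l) / of_nat N - L) = norm (\<Sum>l=1..N. X l - L) / real N"
      by (simp add: norm_divide)
    also have "norm (\<Sum>l=1..N. X l - L) \<le> (\<Sum>l=1..N. norm (X l - L))" by (rule norm_sum)
    also have "\<dots> = K + (\<Sum>l=Suc M..N. norm (X l - L))"
      unfolding K_def using N(3) sum.ub_add_nat[of 1 M "\<lambda>l. norm (X l - L)" "N - M"] by simp
    also have "(\<Sum>l=Suc M..N. norm (X l - L)) \<le> (\<Sum>l=Suc M..N. r / 2)"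
      using M by (intro sum_mono) (auto simp: less_imp_le)
    also have "\<dots> \<le> real N * (r / 2)" using r by simp
    also have "(K + real N * (r / 2)) / real N < r"
    proof -
      have "K < real N * (r / 2)"
        using N0 N(2) r by (simp add: field_simps) (smt (verit) mult_left_mono of_nat_mono)
      then show ?thesis using N(1) by (simp add: field_simps)
    qed
    finally show "norm ((\<Sum>l=1..N. X l) / of_nat N - L) < r" using N(1) by (simp add: divide_right_mono)
  qed
qed

section \<open>Riemann--Stieltjes integrals of psi\<close>

lemma psi_neg: "-1 \<le> w \<Longrightarrow> w < 0 \<Longrightarrow> psi w = w + 1 / 2"
  unfolding psi_def by (subst floor_unique[of "-1"]) auto

lemma psi_nonneg: "0 \<le> w \<Longrightarrow> w < 1 \<Longrightarrow> psi w = w - 1 / 2"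
  unfolding psi_def by (subst floor_unique[of 0]) auto

lemma has_rs_integral_minus:
  assumes "has_rs_integral g f a b I"
  shows "has_rs_integral (\<lambda>u. - g u) f a b (- I)"
proof -
  have "has_rs_integral (\<lambda>_. 0) f a b 0" unfolding has_rs_integral_def by (auto intro: exI[of _ 1])
  from has_rs_integral_diff[OF this assms] show ?thesis by simp
qed

text \<open>Integration by parts from the integral of \<open>f\<close> against an affine integrator.
  It serves each affine branch of \<open>psi\<close>.\<close>

lemma osc_null_has_rs_integral_affine:
  fixes f :: "real \<Rightarrow> complex"
  assumes "osc_null f a b" "a \<le> b"
  shows "has_rs_integral (\<lambda>u. of_real (m * u + k)) f a b
    (of_real (m * b + k) * f b - of_real (m * a + k) * f a - of_real m * integral {a..b} f)"
proof -
  have "has_rs_integral f (\<lambda>u. of_real (m * u + k)) a b (integral {a..b} (\<lambda>u. f u * of_real m))"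
  proof (rule osc_null_has_rs_integral[OF assms])
    fix u
    have "((\<lambda>u. m * u + k) has_real_derivative m) (at u within {a..b})"
      by (auto intro!: derivative_eq_intros)
    then show "((\<lambda>u. complex_of_real (m * u + k)) has_vector_derivative of_real m) (at u within {a..b})"
      by (intro has_vector_derivative_of_real) (simp add: has_real_derivative_iff_has_vector_derivative)
  qed auto
  from has_rs_integral_by_parts[OF this] show ?thesis
    by (simp add: mult.commute)
qed

section \<open>Rules for integrals that are improper at one point\<close>

lemma has_rs_integral_left_cong:
  assumes "\<And>u. u \<in> {a..<b} \<Longrightarrow> g u = g' u"
  shows "has_rs_integral_left g f a b I \<longleftrightarrow> has_rs_integral_left g' f a b I"
proof -
  have "has_rs_integral g f a x J \<longleftrightarrow> has_rs_integral g' f a x J" if "x \<in> {a..<b}" for x J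
    by (rule has_rs_integral_cong) (use that assms in auto)
  then have "(\<forall>x\<in>{a..<b}. has_rs_integral g f a x (J x)) \<longleftrightarrow> (\<forall>x\<in>{a..<b}. has_rs_integral g' f a x (J x))" for J
    by blast
  then show ?thesis unfolding has_rs_integral_left_def by simp
qed

lemma has_rs_integral_right_cong:
  assumes "\<And>u. u \<in> {a<..b} \<Longrightarrow> g u = g' u"
  shows "has_rs_integral_right g f a b I \<longleftrightarrow> has_rs_integral_right g' f a b I"
proof -
  have "has_rs_integral g f x b J \<longleftrightarrow> has_rs_integral g' f x b J" if "x \<in> {a<..b}" for x J
    by (rule has_rs_integral_cong) (use that assms in auto)
  then have "(\<forall>x\<in>{a<..b}. has_rs_integral g f x b (J x)) \<longleftrightarrow> (\<forall>x\<in>{a<..b}. has_rs_integral g' f x b (J x))" for J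
    by blast
  then show ?thesis unfolding has_rs_integral_right_def by simp
qed

lemma has_rs_integral_left_minus:
  "has_rs_integral_left g f a b I \<Longrightarrow> has_rs_integral_left (\<lambda>u. - g u) f a b (- I)"
  unfolding has_rs_integral_left_def
proof (elim exE conjE)
  fix J assume "\<forall>x\<in>{a..<b}. has_rs_integral g f a x (J x)" "(J \<longlongrightarrow> I) (at_left b)"
  then show "\<exists>J. (\<forall>x\<in>{a..<b}. has_rs_integral (\<lambda>u. - g u) f a x (J x)) \<and> (J \<longlongrightarrow> - I) (at_left b)"
    by (intro exI[of _ "\<lambda>x. - J x"] conjI ballI has_rs_integral_minus tendsto_minus) auto
qed

lemma has_rs_integral_right_minus:
  "has_rs_integral_right g f a b I \<Longrightarrow> has_rs_integral_right (\<lambda>u. - g u) f a b (- I)"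
  unfolding has_rs_integral_right_def
proof (elim exE conjE)
  fix J assume "\<forall>x\<in>{a<..b}. has_rs_integral g f x b (J x)" "(J \<longlongrightarrow> I) (at_right a)"
  then show "\<exists>J. (\<forall>x\<in>{a<..b}. has_rs_integral (\<lambda>u. - g u) f x b (J x)) \<and> (J \<longlongrightarrow> - I) (at_right a)"
    by (intro exI[of _ "\<lambda>x. - J x"] conjI ballI has_rs_integral_minus tendsto_minus) auto
qed

lemma has_rs_integral_around_minus:
  "has_rs_integral_around p g f a b I \<Longrightarrow> has_rs_integral_around p (\<lambda>u. - g u) f a b (- I)"
  unfolding has_rs_integral_around_def
  by (metis has_rs_integral_left_minus has_rs_integral_right_minus minus_add_distrib)

lemma has_rs_integral_around_cong:
  assumes "\<And>u. u \<in> {a..b} \<Longrightarrow> u \<noteq> p \<Longrightarrow> g u = g' u" "a \<le> p" "p \<le> b"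
  shows "has_rs_integral_around p g f a b I \<longleftrightarrow> has_rs_integral_around p g' f a b I"
proof -
  have "has_rs_integral_left g f a p J \<longleftrightarrow> has_rs_integral_left g' f a p J" for J
    by (rule has_rs_integral_left_cong) (use assms in auto)
  moreover have "has_rs_integral_right g f p b J \<longleftrightarrow> has_rs_integral_right g' f p b J" for J
    by (rule has_rs_integral_right_cong) (use assms in auto)
  ultimately show ?thesis unfolding has_rs_integral_around_def by simp
qed

text \<open>\<open>a - c < p\<close> keeps the argument of \<open>psi\<close> inside (-1, 0) before
  \<open>a\<close>, so only the branch \<open>L\<close> occurs. Since \<open>L a = 1 / 2\<close>,
  the limit at \<open>a\<close> turns the boundary term into \<open>fm / 2\<close>.\<close>

lemma osc_null_integral_psi_left:
  fixes f :: "real \<Rightarrow> complex"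
  assumes osc: "osc_null f c a" and "c < a" "a - c < p" and lim: "(f \<longlongrightarrow> fm) (at_left a)"
  defines "I \<equiv> fm / 2 - of_real (1 / 2 - (a - c) / p) * f c - 1 / of_real p * integral {c..a} f"
  shows "has_rs_integral_left (\<lambda>u. of_real (psi ((u - a) / p))) f c a I"
    and "f a = fm \<Longrightarrow> has_rs_integral (\<lambda>u. of_real (psi ((u - a) / p))) f c a I"
proof -
  have p: "p > 0" using assms by simp
  define k where "k = 1 / 2 - a / p"
  define L where "L u = 1 / p * u + k" for u
  have L: "L u = (u - a) / p + 1 / 2" for u unfolding L_def k_def by (simp add: diff_divide_distrib)
  have psiL: "psi ((u - a) / p) = L u" if "u \<in> {c..<a}" for u
    unfolding L using that p assms(3) by (intro psi_neg) (auto simp: field_simps)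
  have "osc_null f c x" if "x \<in> {c..a}" for x
    using osc_null_left[OF osc] that by auto
  from osc_null_has_rs_integral_affine[OF this, of _ "1 / p" k]
  have aff: "has_rs_integral (\<lambda>u. of_real (L u)) f c x
      (of_real (L x) * f x - of_real (L c) * f c - 1 / of_real p * integral {c..x} f)"
    if "x \<in> {c..a}" for x using that unfolding L_def by simp
  have int: "f integrable_on {c..a}"
    using osc_null_absolutely_integrable[OF osc] assms(2) set_lebesgue_integral_eq_integral(1) by fastforce
  have Lca: "L a = 1 / 2" "L c = 1 / 2 - (a - c) / p" unfolding L by (simp_all add: diff_divide_distrib)
  show "has_rs_integral_left (\<lambda>u. of_real (psi ((u - a) / p))) f c a I"
    unfolding has_rs_integral_left_def
  proof (intro exI conjI ballI)
    fix x assume x: "x \<in> {c..<a}"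
    show "has_rs_integral (\<lambda>u. of_real (psi ((u - a) / p))) f c x
       (of_real (L x) * f x - of_real (L c) * f c - 1 / of_real p * integral {c..x} f)"
      using aff[of x] x by (subst has_rs_integral_cong[where g' = "\<lambda>u. of_real (L u)"]) (auto simp: psiL)
  next
    have "continuous_on {c..a} (\<lambda>x. integral {c..x} f)" by (rule indefinite_integral_continuous_1[OF int])
    then have 1: "((\<lambda>x. integral {c..x} f) \<longlongrightarrow> integral {c..a} f) (at_left a)"
      using assms(2) by (auto simp: continuous_on_def at_within_Icc_at_left dest: bspec[of _ _ a])
    have 2: "(L \<longlongrightarrow> L a) (at_left a)" unfolding L_def by (intro tendsto_intros)
    have "((\<lambda>x. of_real (L x) * f x - of_real (L c) * f c - 1 / of_real p * integral {c..x} f)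
      \<longlongrightarrow> of_real (L a) * fm - of_real (L c) * f c - 1 / of_real p * integral {c..a} f) (at_left a)"
      by (intro tendsto_intros 1 2 lim)
    then show "((\<lambda>x. of_real (L x) * f x - of_real (L c) * f c - 1 / of_real p * integral {c..x} f)
      \<longlongrightarrow> I) (at_left a)" unfolding I_def Lca by simp
  qed
  assume fa: "f a = fm"
  have "continuous (at a within {c..a}) f"
    using lim assms(2) fa by (simp add: continuous_within at_within_Icc_at_left)
  \<comment> \<open>At the endpoint itself \<open>psi\<close> has already dropped by 1. This
    correction integrates to \<open>f a - f a = 0\<close>, so the proper integral has the value of
    the improper one.\<close>
  then have "has_rs_integral (\<lambda>u. if a \<le> u then 1 else 0) f c a (f a - f a)"
    using assms(2) by (intro has_rs_integral_jump) auto
  from has_rs_integral_diff[OF aff[of a] this]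
  have "has_rs_integral (\<lambda>u. of_real (L u) - (if a \<le> u then 1 else 0)) f c a I"
    using assms(2) fa unfolding I_def Lca by simp
  moreover have "of_real (psi ((u - a) / p)) = complex_of_real (L u) - (if a \<le> u then 1 else 0)"
    if "u \<in> {c..a}" for u
    using psiL[of u] psi_nonneg[of 0] that by (cases "u = a") (auto simp: Lca(1))
  ultimately show "has_rs_integral (\<lambda>u. of_real (psi ((u - a) / p))) f c a I"
    by (subst has_rs_integral_cong[where g' = "\<lambda>u. of_real (L u) - (if a \<le> u then 1 else 0)"]) auto
qed

lemma osc_null_integral_psi_right:
  fixes f :: "real \<Rightarrow> complex"
  assumes osc: "osc_null f a d" and "a < d" "d - a < p" and lim: "(f \<longlongrightarrow> fp) (at_right a)"
  defines "I \<equiv> of_real (1 / 2 - (d - a) / p) * f d - fp / 2 + 1 / of_real p * integral {a..d} f"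
  shows "has_rs_integral_right (\<lambda>u. of_real (psi ((a - u) / p))) f a d I"
    and "f a = fp \<Longrightarrow> has_rs_integral (\<lambda>u. of_real (psi ((a - u) / p))) f a d I"
proof -
  have p: "p > 0" using assms by simp
  define k where "k = 1 / 2 + a / p"
  define L where "L u = - 1 / p * u + k" for u
  have L: "L u = (a - u) / p + 1 / 2" for u unfolding L_def k_def by (simp add: diff_divide_distrib)
  have psiL: "psi ((a - u) / p) = L u" if "u \<in> {a<..d}" for u
    unfolding L using that p assms(3) by (intro psi_neg) (auto simp: field_simps)
  have sub: "osc_null f x d" if "x \<in> {a..d}" for x
    using osc_null_right[OF osc] that by auto
  from osc_null_has_rs_integral_affine[OF this, of _ "- 1 / p" k]
  have aff: "has_rs_integral (\<lambda>u. of_real (L u)) f x d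
      (of_real (L d) * f d - of_real (L x) * f x + 1 / of_real p * integral {x..d} f)"
    if "x \<in> {a..d}" for x using that unfolding L_def by simp
  have int: "f integrable_on {a..d}"
    using osc_null_absolutely_integrable[OF osc] assms(2) set_lebesgue_integral_eq_integral(1) by fastforce
  have Lad: "L a = 1 / 2" "L d = 1 / 2 - (d - a) / p" unfolding L by (simp_all add: diff_divide_distrib)
  show "has_rs_integral_right (\<lambda>u. of_real (psi ((a - u) / p))) f a d I"
    unfolding has_rs_integral_right_def
  proof (intro exI conjI ballI)
    fix x assume x: "x \<in> {a<..d}"
    show "has_rs_integral (\<lambda>u. of_real (psi ((a - u) / p))) f x d
       (of_real (L d) * f d - of_real (L x) * f x + 1 / of_real p * integral {x..d} f)"
      using aff[of x] x by (subst has_rs_integral_cong[where g' = "\<lambda>u. of_real (L u)"]) (auto simp: psiL)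
  next
    have "continuous_on {a..d} (\<lambda>x. integral {x..d} f)" by (rule indefinite_integral_continuous_1'[OF int])
    then have 1: "((\<lambda>x. integral {x..d} f) \<longlongrightarrow> integral {a..d} f) (at_right a)"
      using assms(2) by (auto simp: continuous_on_def at_within_Icc_at_right dest: bspec[of _ _ a])
    have 2: "(L \<longlongrightarrow> L a) (at_right a)" unfolding L_def by (intro tendsto_intros)
    have "((\<lambda>x. of_real (L d) * f d - of_real (L x) * f x + 1 / of_real p * integral {x..d} f)
      \<longlongrightarrow> of_real (L d) * f d - of_real (L a) * fp + 1 / of_real p * integral {a..d} f) (at_right a)"
      by (intro tendsto_intros 1 2 lim)
    then show "((\<lambda>x. of_real (L d) * f d - of_real (L x) * f x + 1 / of_real p * integral {x..d} f)
      \<longlongrightarrow> I) (at_right a)" unfolding I_def Lad by simp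
  qed
  assume fa: "f a = fp"
  have "continuous (at a within {a..d}) f"
    using lim assms(2) fa by (simp add: continuous_within at_within_Icc_at_right)
  \<comment> \<open>Now \<open>psi\<close> equals \<open>L - 1\<close> at \<open>a\<close> and
    \<open>L\<close> beyond it, which calls for the strict inequality. The jump contributes
    \<open>f d - f a\<close>, exactly what the shift by -1 takes away.\<close>
  then have "has_rs_integral (\<lambda>u. if a < u then 1 else 0) f a d (f d - f a)"
    using assms(2) by (intro has_rs_integral_jump) auto
  moreover have "has_rs_integral (\<lambda>u. of_real (L u - 1)) f a d
      (of_real (L d - 1) * f d - of_real (L a - 1) * f a + 1 / of_real p * integral {a..d} f)"
    using osc_null_has_rs_integral_affine[OF osc, of "- 1 / p" "k - 1"] assms(2) unfolding L_def
    by (simp add: algebra_simps)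
  ultimately have "has_rs_integral (\<lambda>u. of_real (L u - 1) - - (if a < u then 1 else 0)) f a d
      (of_real (L d - 1) * f d - of_real (L a - 1) * f a + 1 / of_real p * integral {a..d} f - - (f d - f a))"
    by (intro has_rs_integral_diff has_rs_integral_minus)
  moreover have "of_real (L d - 1) * f d - of_real (L a - 1) * f a + 1 / of_real p * integral {a..d} f - - (f d - f a) = I"
    using fa unfolding I_def Lad by (simp add: algebra_simps)
  moreover have "of_real (psi ((a - u) / p)) = complex_of_real (L u - 1) - - (if a < u then 1 else 0)"
    if "u \<in> {a..d}" for u
    using psiL[of u] psi_nonneg[of 0] that by (cases "u = a") (auto simp: Lad(1))
  ultimately show "has_rs_integral (\<lambda>u. of_real (psi ((a - u) / p))) f a d I"
    by (subst has_rs_integral_cong[where g' = "\<lambda>u. of_real (L u - 1) - - (if a < u then 1 else 0)"]) auto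
qed

lemma osc_null_integral_psi_continuous:
  fixes f :: "real \<Rightarrow> complex"
  assumes osc: "osc_null f c d" and a: "c < a" "a < d" and p: "p = d - c"
    and cont: "isCont f a" and fcd: "f c = f d"
  shows "has_rs_integral (\<lambda>u. of_real (psi ((u - a) / p))) f c d (f a - 1 / of_real p * integral {c..d} f)"
proof -
  have p0: "p > 0" using assms by simp
  define k where "k = 1 / 2 - a / p"
  define L where "L u = 1 / p * u + k" for u
  have L: "L u = (u - a) / p + 1 / 2" for u unfolding L_def k_def by (simp add: diff_divide_distrib)
  have "has_rs_integral (\<lambda>u. of_real (L u)) f c d
      (of_real (L d) * f d - of_real (L c) * f c - 1 / of_real p * integral {c..d} f)"
    using osc_null_has_rs_integral_affine[OF osc, of "1 / p" k] a unfolding L_def by simp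
  moreover have "has_rs_integral (\<lambda>u. if a \<le> u then 1 else 0) f c d (f d - f a)"
    using a cont by (intro has_rs_integral_jump) (auto intro: continuous_at_imp_continuous_at_within)
  ultimately have 1: "has_rs_integral (\<lambda>u. of_real (L u) - (if a \<le> u then 1 else 0)) f c d
      (of_real (L d) * f d - of_real (L c) * f c - 1 / of_real p * integral {c..d} f - (f d - f a))"
    by (rule has_rs_integral_diff)
  \<comment> \<open>The interval is one full period long. Together with \<open>f c = f d\<close>,
    the boundary terms reduce to \<open>f d\<close>, and subtracting the jump
    \<open>f d - f a\<close> leaves \<open>f a\<close>.\<close>
  have e: "L d = L c + 1" unfolding L p using p0 p by (simp add: field_simps)
  have 2: "of_real (L d) * f d - of_real (L c) * f c - 1 / of_real p * integral {c..d} f - (f d - f a)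
     = f a - 1 / of_real p * integral {c..d} f" unfolding fcd e by (simp add: algebra_simps)
  have "of_real (psi ((u - a) / p)) = complex_of_real (L u) - (if a \<le> u then 1 else 0)"
    if "u \<in> {c..d}" for u
  proof (cases "a \<le> u")
    case True
    then have "psi ((u - a) / p) = (u - a) / p - 1 / 2"
      using that a p p0 by (intro psi_nonneg) auto
    then show ?thesis using True by (simp add: L)
  next
    case False
    then have "psi ((u - a) / p) = (u - a) / p + 1 / 2"
      using that a p p0 by (intro psi_neg) (auto simp: field_simps)
    then show ?thesis using False by (simp add: L)
  qed
  then show ?thesis using 1 unfolding 2
    by (subst has_rs_integral_cong[where g' = "\<lambda>u. of_real (L u) - (if a \<le> u then 1 else 0)"]) auto
qed

section \<open>Fejer means\<close>

lemma sum_symmetric_int: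
  fixes g :: "int \<Rightarrow> 'a::comm_monoid_add"
  shows "(\<Sum>n\<in>{- int N..int N} - {0}. g n) = (\<Sum>n=1..N. g (int n) + g (- int n))"
proof (induction N)
  case (Suc N)
  have "{- int (Suc N)..int (Suc N)} - {0} =
     insert (int (Suc N)) (insert (- int (Suc N)) ({- int N..int N} - {0}))" by auto
  then show ?case using Suc by (simp add: ac_simps)
qed simp

lemma sum_symmetric_int_zero:
  fixes g :: "int \<Rightarrow> 'a::comm_monoid_add"
  shows "(\<Sum>n\<in>{- int N..int N}. g n) = g 0 + (\<Sum>n\<in>{- int N..int N} - {0}. g n)"
  by (subst sum.remove[of _ 0]) auto

lemma sum_cis_dirichlet_kernel:
  "(\<Sum>n\<in>{- int N..int N}. cis (2 * pi * of_int n * w)) = of_real (dirichlet_kernel N w)"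
proof -
  have "cis (2 * pi * real n * w) + cis (- (2 * pi * real n * w)) = of_real (2 * cos (2 * pi * real n * w))" for n
    by (simp add: complex_eq_iff)
  then show ?thesis
    unfolding sum_symmetric_int_zero sum_symmetric_int dirichlet_kernel_def
    by (simp add: sum_distrib_left)
qed

lemma sum_exp_sawtooth_sum:
  "(\<Sum>n\<in>{- int N..int N} - {0}. exp (2 * of_real pi * \<i> * of_int n * of_real w)
      / (2 * of_real pi * \<i> * of_int n)) = of_real (sawtooth_sum N w)"
proof -
  have "exp (2 * of_real pi * \<i> * of_int (int n) * of_real w) / (2 * of_real pi * \<i> * of_int (int n))
      + exp (2 * of_real pi * \<i> * of_int (- int n) * of_real w) / (2 * of_real pi * \<i> * of_int (- int n))
      = of_real (sin (2 * pi * real n * w) / (pi * real n))" if "n \<ge> 1" for n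
  proof -
    define x where "x = 2 * pi * real n * w"
    have "exp (2 * of_real pi * \<i> * of_int (int n) * of_real w) = cis x"
      "exp (2 * of_real pi * \<i> * of_int (- int n) * of_real w) = cis (- x)"
      unfolding cis_conv_exp x_def by (simp_all add: mult_ac)
    moreover have "cis x - cis (- x) = 2 * \<i> * of_real (sin x)" by (simp add: complex_eq_iff)
    then have "cis x / (2 * of_real pi * \<i> * of_nat n) - cis (- x) / (2 * of_real pi * \<i> * of_nat n)
       = of_real (sin x) / (of_real pi * of_nat n)"
      by (simp flip: diff_divide_distrib)
    ultimately show ?thesis unfolding x_def[symmetric] by simp
  qed
  then show ?thesis unfolding sum_symmetric_int sawtooth_sum_def of_real_sum by (intro sum.cong) auto
qed

lemma sawtooth_sum_minus: "sawtooth_sum l (- w) = - sawtooth_sum l w"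
  unfolding sawtooth_sum_def by (simp add: sum_negf)

lemma sawtooth_sum_periodic: "sawtooth_sum l (w + 1) = sawtooth_sum l w"
proof -
  have "sin (2 * pi * real n * (w + 1)) = sin (2 * pi * real n * w)" for n
    using sin_add[of "2 * pi * real n * w" "2 * pi * real n"]
      sin_npi[of "2 * n"] cos_npi[of "2 * n"] by (simp add: algebra_simps)
  then show ?thesis unfolding sawtooth_sum_def by simp
qed

text \<open>0 is excluded because every partial sum vanishes there while
  \<open>- psi 0 = 1 / 2\<close>. The integral around \<open>a\<close> does not see this
  discrepancy.\<close>

lemma sawtooth_sum_tendsto_psi:
  assumes "-1 < w" "w < 1" "w \<noteq> 0"
  shows "(\<lambda>l. sawtooth_sum l w) \<longlonglongrightarrow> - psi w"
proof (cases "w > 0")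
  case True
  then show ?thesis using sawtooth_sum_tendsto[of w] psi_nonneg[of w] assms by simp
next
  case False
  then have "(\<lambda>l. - sawtooth_sum l (- w)) \<longlonglongrightarrow> - (1 / 2 - - w)"
    using assms by (intro tendsto_minus sawtooth_sum_tendsto) auto
  moreover have "- psi w = - (1 / 2 - - w)" using psi_neg[of w] assms False by simp
  ultimately show ?thesis by (simp add: sawtooth_sum_minus)
qed

text \<open>\<open>w + sawtooth_sum l w\<close> is an antiderivative of the kernel, and
  \<open>p\<close> comes from the substitution \<open>w = (u - a) / p\<close>.\<close>

lemma dirichlet_kernel_has_integral:
  assumes "x \<le> y" "p > 0"
  shows "((\<lambda>u. dirichlet_kernel l ((u - a) / p)) has_integral
    p * (((y - a) / p + sawtooth_sum l ((y - a) / p)) - ((x - a) / p + sawtooth_sum l ((x - a) / p)))) {x..y}"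
proof -
  have "((\<lambda>u. p * ((u - a) / p + sawtooth_sum l ((u - a) / p))) has_real_derivative
     dirichlet_kernel l ((u - a) / p)) (at u within {x..y})" for u
  proof -
    have 1: "((\<lambda>u. (u - a) / p) has_real_derivative 1 / p) (at u within {x..y})"
      using assms(2) by (auto intro!: derivative_eq_intros)
    have "((\<lambda>u. sawtooth_sum l ((u - a) / p)) has_real_derivative
        (dirichlet_kernel l ((u - a) / p) - 1) * (1 / p)) (at u within {x..y})"
      by (rule DERIV_chain2[OF _ 1]) (rule sawtooth_sum_has_derivative)
    from DERIV_cmult[OF DERIV_add[OF 1 this], of p] show ?thesis
      using assms(2) by (simp add: field_simps)
  qed
  then have "((\<lambda>u. dirichlet_kernel l ((u - a) / p)) has_integral
    p * ((y - a) / p + sawtooth_sum l ((y - a) / p)) - p * ((x - a) / p + sawtooth_sum l ((x - a) / p))) {x..y}"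
    by (intro fundamental_theorem_of_calculus[OF assms(1)])
       (simp add: has_real_derivative_iff_has_vector_derivative)
  then show ?thesis by (simp add: right_diff_distrib)
qed

lemma continuous_on_dirichlet_kernel: "continuous_on S (\<lambda>u. dirichlet_kernel l ((u - a) / p))"
  unfolding dirichlet_kernel_def divide_inverse by (intro continuous_intros)

text \<open>Near \<open>a\<close> the factor \<open>h\<close> is small and the mass of
  \<open>F N\<close> grows only linearly in \<open>N\<close>; far from \<open>a\<close> the kernel
  is bounded uniformly in \<open>N\<close>. Both contributions are controlled after division by
  \<open>N\<close>.\<close>

lemma approximate_identity_null:
  fixes h :: "real \<Rightarrow> complex" and F :: "nat \<Rightarrow> real \<Rightarrow> real"
  assumes h: "h absolutely_integrable_on {c..d}" "h a = 0" "(h \<longlongrightarrow> 0) (at a)"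
    and F: "\<And>N. continuous_on {c..d} (F N)" "\<And>N u. u \<in> {c..d} \<Longrightarrow> F N u \<ge> 0"
    and C: "\<And>N. integral {c..d} (F N) \<le> C * (real N + 1)" "C > 0"
    and K: "\<And>\<rho>. \<rho> > 0 \<Longrightarrow> \<exists>K. \<forall>N. \<forall>u\<in>{c..d}. \<rho> \<le> \<bar>u - a\<bar> \<longrightarrow> F N u \<le> K"
  shows "(\<lambda>N. integral {c..d} (\<lambda>u. h u * of_real (F N u)) / of_nat N) \<longlonglongrightarrow> 0"
proof (rule LIMSEQ_I)
  fix r :: real assume r: "r > 0"
  \<comment> \<open>Since \<open>N + 1 \<le> 2 * N\<close>, this choice keeps the part near
    \<open>a\<close> below \<open>r / 2\<close> after division by \<open>N\<close>.\<close>
  define \<epsilon> where "\<epsilon> = r / (4 * C)"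
  have \<epsilon>: "\<epsilon> > 0" using r C(2) unfolding \<epsilon>_def by simp
  obtain \<rho> where \<rho>: "\<rho> > 0" "\<And>u. u \<noteq> a \<Longrightarrow> \<bar>u - a\<bar> < \<rho> \<Longrightarrow> norm (h u) < \<epsilon>"
    using LIM_D[OF h(3) \<epsilon>] by (auto simp: norm_minus_commute)
  obtain K0 where K0: "\<And>N u. u \<in> {c..d} \<Longrightarrow> \<rho> \<le> \<bar>u - a\<bar> \<Longrightarrow> F N u \<le> K0"
    using K[OF \<rho>(1)] by blast
  \<comment> \<open>If no point of the interval is as far as \<rho> from \<open>a\<close>,
    \<open>K0\<close> is arbitrary and may be negative.\<close>
  define K1 where "K1 = max 0 K0"
  define H where "H = integral {c..d} (\<lambda>u. norm (h u))"
  have hint: "h integrable_on {c..d}" "(\<lambda>u. norm (h u)) integrable_on {c..d}"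
    using h(1) unfolding absolutely_integrable_on_def by auto
  have Fint: "F N integrable_on {c..d}" for N using F(1) by (rule integrable_continuous_real)
  have bound: "norm (integral {c..d} (\<lambda>u. h u * of_real (F N u))) \<le> \<epsilon> * (C * (real N + 1)) + K1 * H" for N
  proof -
    have "(\<lambda>u. h u * of_real (F N u)) absolutely_integrable_on {c..d}"
      by (intro absolutely_integrable_mult_continuous[OF h(1)] continuous_on_of_real F)
    then have 1: "(\<lambda>u. h u * of_real (F N u)) integrable_on {c..d}"
      by (rule set_lebesgue_integral_eq_integral(1))
    have "norm (integral {c..d} (\<lambda>u. h u * of_real (F N u)))
        \<le> integral {c..d} (\<lambda>u. \<epsilon> * F N u + K1 * norm (h u))"
    proof (rule integral_norm_bound_integral[OF 1])
      show "(\<lambda>u. \<epsilon> * F N u + K1 * norm (h u)) integrable_on {c..d}"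
        by (intro integrable_add integrable_on_mult_right Fint hint)
      fix u assume u: "u \<in> {c..d}"
      have F0: "F N u \<ge> 0" by (rule F(2)[OF u])
      consider "u = a" | "u \<noteq> a" "\<bar>u - a\<bar> < \<rho>" | "\<bar>u - a\<bar> \<ge> \<rho>" by linarith
      then show "norm (h u * of_real (F N u)) \<le> \<epsilon> * F N u + K1 * norm (h u)"
      proof cases
        case 1
        then show ?thesis using h(2) F0 \<epsilon> by simp
      next
        case 2
        then have "norm (h u) * F N u \<le> \<epsilon> * F N u" using \<rho>(2)[OF 2] F0 by (intro mult_right_mono) auto
        moreover have "0 \<le> K1 * norm (h u)" unfolding K1_def by simp
        ultimately show ?thesis using F0 by (simp add: norm_mult)
      next
        case 3
        then have "norm (h u) * F N u \<le> norm (h u) * K1"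
          using K0[OF u] unfolding K1_def by (intro mult_left_mono) (auto simp: le_max_iff_disj)
        moreover have "0 \<le> \<epsilon> * F N u" using \<epsilon> F0 by simp
        ultimately show ?thesis using F0 by (simp add: norm_mult mult.commute)
      qed
    qed
    also have "\<dots> = \<epsilon> * integral {c..d} (F N) + K1 * H"
      unfolding H_def by (subst Henstock_Kurzweil_Integration.integral_add)
        (auto intro!: integrable_on_mult_right Fint hint)
    also have "\<dots> \<le> \<epsilon> * (C * (real N + 1)) + K1 * H"
      using C(1) \<epsilon> by (intro add_right_mono mult_left_mono) auto
    finally show ?thesis .
  qed
  obtain N0 :: nat where N0: "N0 > 2 * (K1 * H) / r" using reals_Archimedean2 by blast
  show "\<exists>no. \<forall>N\<ge>no. norm (integral {c..d} (\<lambda>u. h u * of_real (F N u)) / of_nat N - 0) < r"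
  proof (intro exI[of _ "max 1 N0"] allI impI)
    fix N assume "N \<ge> max 1 N0"
    then have N: "real N \<ge> 1" "real N \<ge> real N0" by auto
    have "2 * (K1 * H) < real N0 * r" using N0 r by (simp add: pos_divide_less_eq)
    also have "\<dots> \<le> real N * r" using N(2) r by (intro mult_right_mono) auto
    finally have 1: "2 * (K1 * H) < real N * r" .
    have "\<epsilon> * (C * (real N + 1)) = r / 4 * (real N + 1)" using C(2) by (simp add: \<epsilon>_def)
    also have "\<dots> \<le> r / 4 * (2 * real N)" using r N(1) by (intro mult_left_mono) auto
    finally have "\<epsilon> * (C * (real N + 1)) + K1 * H < r * real N" using 1 by (simp add: mult.commute)
    then have "norm (integral {c..d} (\<lambda>u. h u * of_real (F N u))) < r * real N" using bound[of N] by linarith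
    then show "norm (integral {c..d} (\<lambda>u. h u * of_real (F N u)) / of_nat N - 0) < r"
      using N(1) by (simp add: norm_divide divide_less_eq)
  qed
qed

text \<open>The antiderivative vanishes at \<open>a\<close>. At distance \<open>w\<close> in (0, 1),
  \<open>sawtooth_sum l w\<close> tends to \<open>1 / 2 - w\<close>, so the linear term cancels and
  both halves have the same limit wherever \<open>a\<close> lies.\<close>

lemma dirichlet_integral_halves:
  assumes "c < a" "a < d" "p = d - c"
  shows "(\<lambda>l. integral {c..a} (\<lambda>u. dirichlet_kernel l ((u - a) / p))) \<longlonglongrightarrow> p / 2"
    and "(\<lambda>l. integral {a..d} (\<lambda>u. dirichlet_kernel l ((u - a) / p))) \<longlonglongrightarrow> p / 2"
proof -
  have p: "p > 0" using assms by simp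
  have 0: "sawtooth_sum l 0 = 0" for l by (simp add: sawtooth_sum_def)
  have "integral {c..a} (\<lambda>u. dirichlet_kernel l ((u - a) / p)) = p * ((a - c) / p + sawtooth_sum l ((a - c) / p))" for l
  proof -
    have "(c - a) / p = - ((a - c) / p)" by (simp add: diff_divide_distrib)
    then show ?thesis
      using integral_unique[OF dirichlet_kernel_has_integral[of c a p l a]] assms(1) p
      by (simp only: sawtooth_sum_minus) (simp add: 0)
  qed
  moreover have "(\<lambda>l. p * ((a - c) / p + sawtooth_sum l ((a - c) / p))) \<longlonglongrightarrow> p * ((a - c) / p + (1 / 2 - (a - c) / p))"
    using assms p by (intro tendsto_intros sawtooth_sum_tendsto) auto
  ultimately show "(\<lambda>l. integral {c..a} (\<lambda>u. dirichlet_kernel l ((u - a) / p))) \<longlonglongrightarrow> p / 2" by simp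
  have "integral {a..d} (\<lambda>u. dirichlet_kernel l ((u - a) / p)) = p * ((d - a) / p + sawtooth_sum l ((d - a) / p))" for l
    using integral_unique[OF dirichlet_kernel_has_integral[of a d p l a]] assms(2) p
    by (simp add: 0)
  moreover have "(\<lambda>l. p * ((d - a) / p + sawtooth_sum l ((d - a) / p))) \<longlonglongrightarrow> p * ((d - a) / p + (1 / 2 - (d - a) / p))"
    using assms p by (intro tendsto_intros sawtooth_sum_tendsto) auto
  ultimately show "(\<lambda>l. integral {a..d} (\<lambda>u. dirichlet_kernel l ((u - a) / p))) \<longlonglongrightarrow> p / 2" by simp
qed

lemma fejer_mean_null:
  fixes h :: "real \<Rightarrow> complex"
  assumes a: "c < a" "a < d" and p: "p = d - c"
    and h: "h absolutely_integrable_on {c..d}" "h a = 0" "(h \<longlongrightarrow> 0) (at a)"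
  shows "(\<lambda>N. (\<Sum>l=1..N. integral {c..d} (\<lambda>u. h u * of_real (dirichlet_kernel l ((u - a) / p)))) / of_nat N) \<longlonglongrightarrow> 0"
proof -
  have p0: "p > 0" using assms by simp
  define F where "F N u = (\<Sum>l\<le>N. dirichlet_kernel l ((u - a) / p))" for N u
  have hD: "(\<lambda>u. h u * of_real (dirichlet_kernel l ((u - a) / p))) integrable_on {c..d}" for l
    by (intro set_lebesgue_integral_eq_integral(1) absolutely_integrable_mult_continuous[OF h(1)]
       continuous_on_of_real continuous_on_dirichlet_kernel)
  have "(\<lambda>N. integral {c..d} (\<lambda>u. h u * of_real (F N u)) / of_nat N) \<longlonglongrightarrow> 0"
  proof (rule approximate_identity_null[OF h])
    show "continuous_on {c..d} (F N)" for N
      unfolding F_def by (intro continuous_on_sum continuous_on_dirichlet_kernel)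
    show "F N u \<ge> 0" for N u unfolding F_def by (rule fejer_sum_nonneg)
    show "integral {c..d} (F N) \<le> p * (real N + 1)" for N
    proof -
      have "((\<lambda>u. dirichlet_kernel l ((u - a) / p)) has_integral p) {c..d}" for l
      proof -
        \<comment> \<open>Over a full period the sawtooth terms at the two ends cancel, so each
          kernel has mass exactly \<open>p\<close>.\<close>
        have e: "(d - a) / p = (c - a) / p + 1" using p0 p by (simp add: field_simps)
        show ?thesis using dirichlet_kernel_has_integral[of c d p l a] a p0
          by (simp add: e sawtooth_sum_periodic)
      qed
      then have "(F N has_integral (\<Sum>l\<le>N. p)) {c..d}" unfolding F_def
        by (intro has_integral_sum) auto
      then show ?thesis by (simp add: integral_unique algebra_simps)
    qed
    show "\<exists>K. \<forall>N. \<forall>u\<in>{c..d}. \<rho> \<le> \<bar>u - a\<bar> \<longrightarrow> F N u \<le> K" if "\<rho> > 0" for \<rho>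
    proof -
      define S where "S = {c..d} \<inter> {u. \<rho> \<le> \<bar>u - a\<bar>}"
      have nz: "sin (pi * ((u - a) / p)) \<noteq> 0" if "u \<in> S" for u
      proof -
        have u: "u \<in> {c..d}" "u \<noteq> a" using that \<open>\<rho> > 0\<close> unfolding S_def by auto
        \<comment> \<open>As \<open>a\<close> is interior, 0 is the only integer that
          \<open>(u - a) / p\<close> can reach, and points of \<open>S\<close> avoid it. The sine
          thus has no zero on the compact set \<open>S\<close>.\<close>
        then have w: "\<bar>(u - a) / p\<bar> < 1" "(u - a) / p \<noteq> 0" using a p p0 by (auto simp: field_simps abs_less_iff)
        have "0 < pi * \<bar>(u - a) / p\<bar>" using w(2) by simp
        moreover have "pi * \<bar>(u - a) / p\<bar> < pi * 1" using w(1) by (intro mult_strict_left_mono) auto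
        ultimately have "sin (pi * \<bar>(u - a) / p\<bar>) > 0" by (intro sin_gt_zero) simp_all
        moreover have "sin (pi * \<bar>w\<bar>) \<noteq> 0 \<Longrightarrow> sin (pi * w) \<noteq> 0" for w :: real
          by (cases "w \<ge> 0") auto
        ultimately show ?thesis by (metis less_irrefl)
      qed
      have "closed {u. \<rho> \<le> \<bar>u - a\<bar>}" by (intro closed_Collect_le continuous_intros)
      then have "compact S" unfolding S_def by (intro compact_Int_closed) auto
      moreover have "continuous_on S (\<lambda>u. 1 / (sin (pi * ((u - a) / p)))\<^sup>2)"
        using nz p0 by (intro continuous_intros) auto
      ultimately have "bounded ((\<lambda>u. 1 / (sin (pi * ((u - a) / p)))\<^sup>2) ` S)"
        using compact_continuous_image compact_imp_bounded by blast
      then obtain K where K: "\<And>u. u \<in> S \<Longrightarrow> \<bar>1 / (sin (pi * ((u - a) / p)))\<^sup>2\<bar> \<le> K"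
        unfolding bounded_iff by auto
      have "F N u \<le> K" if "u \<in> S" for N u
        using fejer_sum_le[OF nz[OF that], of N] K[OF that] unfolding F_def by linarith
      then show ?thesis unfolding S_def by blast
    qed
  qed (use p0 in auto)
  \<comment> \<open>\<open>F N\<close> includes \<open>l = 0\<close>, where the kernel is constantly
    1, while the means start at \<open>l = 1\<close>. The surplus is the integral of
    \<open>h\<close>, which vanishes after division by \<open>N\<close>.\<close>
  moreover have "(\<lambda>N. integral {c..d} h / of_nat N) \<longlonglongrightarrow> 0"
    by (rule lim_const_over_n)
  ultimately have "(\<lambda>N. integral {c..d} (\<lambda>u. h u * of_real (F N u)) / of_nat N - integral {c..d} h / of_nat N) \<longlonglongrightarrow> 0 - 0"
    by (rule tendsto_diff)
  moreover have "(\<Sum>l=1..N. integral {c..d} (\<lambda>u. h u * of_real (dirichlet_kernel l ((u - a) / p))))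
     = integral {c..d} (\<lambda>u. h u * of_real (F N u)) - integral {c..d} h" for N
  proof -
    have "integral {c..d} (\<lambda>u. h u * of_real (F N u))
       = (\<Sum>l\<le>N. integral {c..d} (\<lambda>u. h u * of_real (dirichlet_kernel l ((u - a) / p))))"
      unfolding F_def of_real_sum sum_distrib_left by (rule integral_sum) (auto simp: hD)
    also have "\<dots> = integral {c..d} (\<lambda>u. h u * of_real (dirichlet_kernel 0 ((u - a) / p)))
       + (\<Sum>l=1..N. integral {c..d} (\<lambda>u. h u * of_real (dirichlet_kernel l ((u - a) / p))))"
      by (simp only: atMost_atLeast0 sum.atLeast_Suc_atMost[OF le0] One_nat_def)
    finally show ?thesis by (simp add: dirichlet_kernel_def)
  qed
  ultimately show ?thesis by (simp add: diff_divide_distrib)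
qed

lemma fejer_mean_tendsto:
  fixes f :: "real \<Rightarrow> complex"
  assumes a: "c < a" "a < d" and p: "p = d - c"
    and f: "f absolutely_integrable_on {c..d}"
    and lim: "(f \<longlongrightarrow> fm) (at_left a)" "(f \<longlongrightarrow> fp) (at_right a)"
  shows "(\<lambda>N. (\<Sum>l=1..N. integral {c..d} (\<lambda>u. f u * of_real (dirichlet_kernel l ((u - a) / p)))) / of_nat N)
    \<longlonglongrightarrow> of_real p * ((fp + fm) / 2)"
proof -
  have p0: "p > 0" using assms by simp
  define D where "D l u = complex_of_real (dirichlet_kernel l ((u - a) / p))" for l u
  \<comment> \<open>The value \<open>f a\<close> at the jump makes \<open>h a = 0\<close>.\<close>
  define j where "j u = (if u < a then fm else if u > a then fp else f a)" for u
  define h where "h u = f u - j u" for u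
  define jl jr where "jl l = fm * of_real (integral {c..a} (\<lambda>u. dirichlet_kernel l ((u - a) / p)))"
    and "jr l = fp * of_real (integral {a..d} (\<lambda>u. dirichlet_kernel l ((u - a) / p)))" for l
  have j: "((\<lambda>u. j u * g u) has_integral (fm * G1 + fp * G2)) {c..d}"
    if "(g has_integral G1) {c..a}" "(g has_integral G2) {a..d}" for g :: "real \<Rightarrow> complex" and G1 G2
  proof (rule has_integral_combine[of c a d])
    show "((\<lambda>u. j u * g u) has_integral fm * G1) {c..a}"
      by (rule has_integral_spike[OF negligible_sing[of a] _ has_integral_mult_right[OF that(1)]]) (auto simp: j_def)
    show "((\<lambda>u. j u * g u) has_integral fp * G2) {a..d}"
      by (rule has_integral_spike[OF negligible_sing[of a] _ has_integral_mult_right[OF that(2)]]) (auto simp: j_def)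
  qed (use a in auto)
  have "((\<lambda>u. j u * 1) has_integral (fm * of_real (a - c) + fp * of_real (d - a))) {c..d}"
    using has_integral_const_real[of "1::complex"] a
    by (intro j) (metis has_integral_const_real measure_lborel_Icc less_imp_le scaleR_conv_of_real mult.right_neutral)+
  then have "j integrable_on {c..d}" by (auto simp: integrable_on_def)
  then have "j absolutely_integrable_on {c..d}"
    by (rule absolutely_integrable_integrable_bound[of _ _ "\<lambda>_. norm fm + norm fp + norm (f a)", rotated])
       (auto simp: j_def intro: integrable_const_ivl)
  then have h: "h absolutely_integrable_on {c..d}" unfolding h_def by (rule set_integral_diff(1)[OF f])
  have "(h \<longlongrightarrow> 0) (at a)"
  proof (rule filterlim_split_at_real)
    have "((\<lambda>u. f u - fm) \<longlongrightarrow> fm - fm) (at_left a)" by (intro tendsto_intros lim)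
    moreover have "\<forall>\<^sub>F u in at_left a. f u - fm = h u"
      by (auto simp: eventually_at_filter h_def j_def)
    ultimately show "(h \<longlongrightarrow> 0) (at_left a)" by (auto intro: Lim_transform_eventually)
    have "((\<lambda>u. f u - fp) \<longlongrightarrow> fp - fp) (at_right a)" by (intro tendsto_intros lim)
    moreover have "\<forall>\<^sub>F u in at_right a. f u - fp = h u"
      by (auto simp: eventually_at_filter h_def j_def)
    ultimately show "(h \<longlongrightarrow> 0) (at_right a)" by (auto intro: Lim_transform_eventually)
  qed
  then have 1: "(\<lambda>N. (\<Sum>l=1..N. integral {c..d} (\<lambda>u. h u * D l u)) / of_nat N) \<longlonglongrightarrow> 0"
    unfolding D_def by (intro fejer_mean_null[OF a p h]) (simp_all add: h_def j_def)
  have hD: "(\<lambda>u. h u * D l u) integrable_on {c..d}" for l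
    unfolding D_def by (intro set_lebesgue_integral_eq_integral(1) continuous_on_dirichlet_kernel
        absolutely_integrable_mult_continuous[OF h] continuous_on_of_real)
  \<comment> \<open>The jump part converges outright; its Cesaro means inherit the limit.\<close>
  have "(\<lambda>l. jl l + jr l) \<longlonglongrightarrow> fm * of_real (p / 2) + fp * of_real (p / 2)"
    unfolding jl_def jr_def by (intro tendsto_intros dirichlet_integral_halves[OF a p])
  from tendsto_add[OF 1 cesaro_mean_tendsto[OF this]]
  have "(\<lambda>N. (\<Sum>l=1..N. integral {c..d} (\<lambda>u. h u * D l u) + (jl l + jr l)) / of_nat N)
     \<longlonglongrightarrow> of_real p * ((fp + fm) / 2)"
    by (simp add: add_divide_distrib sum.distrib algebra_simps)
  moreover have "integral {c..d} (\<lambda>u. f u * D l u) = integral {c..d} (\<lambda>u. h u * D l u) + (jl l + jr l)" for l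
  proof -
    have D: "(D l has_integral of_real (integral {x..y} (\<lambda>u. dirichlet_kernel l ((u - a) / p)))) {x..y}" for x y
      unfolding D_def by (intro has_integral_of_real integrable_integral integrable_continuous_real
        continuous_on_dirichlet_kernel)
    have "((\<lambda>u. h u * D l u + j u * D l u) has_integral
        integral {c..d} (\<lambda>u. h u * D l u) + (jl l + jr l)) {c..d}"
      unfolding jl_def jr_def by (intro has_integral_add j D integrable_integral hD)
    then show ?thesis unfolding h_def by (intro integral_unique) (simp add: algebra_simps)
  qed
  ultimately show ?thesis unfolding D_def by simp
qed

section \<open>Fourier series\<close>

lemma fourier_partial_sum_integral:
  fixes f :: "real \<Rightarrow> complex" and cf :: "int \<Rightarrow> complex"
  assumes f: "f absolutely_integrable_on {c..d}" and \<delta>: "\<delta> > 0"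
    and cf: "\<And>n. cf n = 1 / of_real (2 * \<delta>) *
      integral {c..d} (\<lambda>u. f u * exp (- (of_real pi * \<i> * of_int n * of_real u / of_real \<delta>)))"
  shows "cf n * exp (of_real pi * \<i> * of_int n * of_real a / of_real \<delta>) = 1 / of_real (2 * \<delta>) *
      integral {c..d} (\<lambda>u. f u * cis (2 * pi * of_int (- n) * ((u - a) / (2 * \<delta>))))"
    and "(\<Sum>n\<in>{- int l..int l}. cf n * exp (of_real pi * \<i> * of_int n * of_real a / of_real \<delta>))
      = 1 / of_real (2 * \<delta>) * integral {c..d} (\<lambda>u. f u * of_real (dirichlet_kernel l ((u - a) / (2 * \<delta>))))"
proof -
  define e where "e n u = cis (2 * pi * of_int n * ((u - a) / (2 * \<delta>)))" for n :: int and u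
  have int: "(\<lambda>u. f u * e n u) integrable_on {c..d}" for n
    unfolding e_def cis_conv_exp
    by (intro set_lebesgue_integral_eq_integral(1) absolutely_integrable_mult_continuous[OF f] continuous_intros)
       (use \<delta> in auto)
  have exp_e: "exp (- (of_real pi * \<i> * of_int n * of_real u / of_real \<delta>)) * exp (of_real pi * \<i> * of_int n * of_real a / of_real \<delta>)
      = e (- n) u" for n u
    unfolding e_def cis_conv_exp exp_add[symmetric]
    by (rule arg_cong[of _ _ exp]) (use \<delta> in \<open>simp add: field_simps\<close>)
  have coeff: "cf n * exp (of_real pi * \<i> * of_int n * of_real a / of_real \<delta>) =
      1 / of_real (2 * \<delta>) * integral {c..d} (\<lambda>u. f u * e (- n) u)" for n
    unfolding cf exp_e[symmetric] by (simp only: mult.assoc[symmetric] integral_mult_left)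
  show "cf n * exp (of_real pi * \<i> * of_int n * of_real a / of_real \<delta>) = 1 / of_real (2 * \<delta>) *
      integral {c..d} (\<lambda>u. f u * cis (2 * pi * of_int (- n) * ((u - a) / (2 * \<delta>))))"
    using coeff unfolding e_def .
  \<comment> \<open>The conjugate exponential in the coefficient produces \<open>- n\<close>;
    reflecting the symmetric range removes the sign.\<close>
  have "(\<Sum>n\<in>{- int l..int l}. integral {c..d} (\<lambda>u. f u * e (- n) u))
     = (\<Sum>n\<in>{- int l..int l}. integral {c..d} (\<lambda>u. f u * e n u))"
    by (rule sum.reindex_bij_witness[of _ uminus uminus]) auto
  also have "\<dots> = integral {c..d} (\<lambda>u. \<Sum>n\<in>{- int l..int l}. f u * e n u)"
    by (rule integral_sum[symmetric]) (auto simp: int)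
  also have "\<dots> = integral {c..d} (\<lambda>u. f u * of_real (dirichlet_kernel l ((u - a) / (2 * \<delta>))))"
    unfolding sum_distrib_left[symmetric] e_def sum_cis_dirichlet_kernel ..
  finally show "(\<Sum>n\<in>{- int l..int l}. cf n * exp (of_real pi * \<i> * of_int n * of_real a / of_real \<delta>))
      = 1 / of_real (2 * \<delta>) * integral {c..d} (\<lambda>u. f u * of_real (dirichlet_kernel l ((u - a) / (2 * \<delta>))))"
    unfolding coeff by (simp only: sum_distrib_left[symmetric])
qed

text \<open>By parts, with no boundary terms: the exponential has period \<open>2 * \<delta>\<close>
  and \<open>f c = f d\<close>. Uniqueness identifies the given \<open>E\<close> with the computed
  value.\<close>

lemma rs_integral_exp:
  fixes f :: "real \<Rightarrow> complex"
  assumes osc: "osc_null f c d" and cd: "c < d" "2 * \<delta> = d - c" and fcd: "f c = f d"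
    and E: "has_rs_integral (\<lambda>u. exp (2 * of_real pi * \<i> * of_int n * of_real ((u - a) / (2 * \<delta>)))) f c d E"
  shows "E = - (2 * of_real pi * \<i> * of_int n) *
    (1 / of_real (2 * \<delta>) * integral {c..d} (\<lambda>u. f u * cis (2 * pi * of_int n * ((u - a) / (2 * \<delta>)))))"
proof -
  define w where "w = 2 * pi * real_of_int n / (2 * \<delta>)"
  define e where "e u = cis (w * (u - a))" for u
  have exp_e: "exp (2 * of_real pi * \<i> * of_int n * of_real ((u - a) / (2 * \<delta>))) = e u"
    and cis_e: "cis (2 * pi * of_int n * ((u - a) / (2 * \<delta>))) = e u" for u
    unfolding e_def w_def cis_conv_exp
    by (rule arg_cong[of _ _ exp], use cd in \<open>simp add: field_simps\<close>)+
  have "has_rs_integral f e c d (integral {c..d} (\<lambda>u. f u * (of_real w * \<i> * e u)))"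
  proof (rule osc_null_has_rs_integral[OF osc])
    fix u
    have "((\<lambda>u. exp (\<i> * of_real w * (of_real u - of_real a))) has_vector_derivative
        of_real w * \<i> * exp (\<i> * of_real w * (of_real u - of_real a))) (at u within {c..d})"
      by (rule has_vector_derivative_real_field) (auto intro!: derivative_eq_intros)
    then show "(e has_vector_derivative of_real w * \<i> * e u) (at u within {c..d})"
      unfolding e_def cis_conv_exp by (simp add: mult.assoc)
    show "continuous_on {c..d} (\<lambda>u. of_real w * \<i> * e u)"
      unfolding e_def cis_conv_exp by (intro continuous_intros)
  qed (use cd in auto)
  from has_rs_integral_by_parts[OF this]
  have "has_rs_integral e f c d (f d * e d - f c * e c - integral {c..d} (\<lambda>u. f u * (of_real w * \<i> * e u)))" .
  moreover have "e d = e c"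
  proof -
    have "d = c + 2 * \<delta>" "\<delta> \<noteq> 0" using cd by auto
    then have "w * (d - a) = w * (c - a) + 2 * pi * real_of_int n"
      unfolding w_def by (simp add: field_simps)
    then show ?thesis unfolding e_def by (simp add: cis_mult[symmetric] cis_multiple_2pi)
  qed
  ultimately have "E = - integral {c..d} (\<lambda>u. f u * (of_real w * \<i> * e u))"
    using has_rs_integral_unique[OF less_imp_le[OF cd(1)] E] fcd by (simp only: exp_e) simp
  also have "integral {c..d} (\<lambda>u. f u * (of_real w * \<i> * e u)) = of_real w * \<i> * integral {c..d} (\<lambda>u. f u * e u)"
    unfolding integral_mult_right[symmetric] by (simp add: mult_ac)
  finally show ?thesis unfolding cis_e w_def by (simp add: mult_ac)
qed

theorem theorem1:
  fixes c d \<delta> a :: real and f :: "real \<Rightarrow> complex" and fm fp :: complex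
    and cf :: "int \<Rightarrow> complex"
  assumes "c < d"
    and "2 * \<delta> = d - c"
    and "riemann_integrable f c d"
    and "c < a" "a < d"
    and "\<And>n. cf n = 1 / of_real (2 * \<delta>) *
               integral {c..d} (\<lambda>u. f u * exp (- (of_real pi * \<i> * of_int n * of_real u / of_real \<delta>)))"
  shows
    "((f \<longlongrightarrow> fm) (at_left a) \<longrightarrow>
       (\<exists>I. has_rs_integral_left (\<lambda>u. of_real (psi ((u - a) / (2 * \<delta>)))) f c a I \<and>
            (f a = fm \<longrightarrow> has_rs_integral (\<lambda>u. of_real (psi ((u - a) / (2 * \<delta>)))) f c a I) \<and>
            fm / 2 = 1 / of_real (2 * \<delta>) * integral {c..a} f + I
                     + f c * of_real (1 / 2 - (a - c) / (2 * \<delta>))))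
     \<and>
     ((f \<longlongrightarrow> fp) (at_right a) \<longrightarrow>
       (\<exists>I. has_rs_integral_right (\<lambda>u. of_real (psi ((a - u) / (2 * \<delta>)))) f a d I \<and>
            (f a = fp \<longrightarrow> has_rs_integral (\<lambda>u. of_real (psi ((a - u) / (2 * \<delta>)))) f a d I) \<and>
            fp / 2 = 1 / of_real (2 * \<delta>) * integral {a..d} f - I
                     + f d * of_real (1 / 2 - (d - a) / (2 * \<delta>))))
     \<and>
     ((f \<longlongrightarrow> fp) (at_right a) \<and> (f \<longlongrightarrow> fm) (at_left a) \<and> f c = f d \<longrightarrow>
       (\<exists>I. has_rs_integral_around a (\<lambda>u. of_real (psi ((u - a) / (2 * \<delta>)))) f c d I \<and>
            (f a = fp \<and> f a = fm \<longrightarrow>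
               has_rs_integral (\<lambda>u. of_real (psi ((u - a) / (2 * \<delta>)))) f c d I) \<and>
            (fp + fm) / 2 = 1 / of_real (2 * \<delta>) * integral {c..d} f + I) \<and>
       ((\<exists>J E.
           has_rs_integral_around a
             (\<lambda>u. lim (\<lambda>N. \<Sum>n\<in>{- int N..int N} - {0}.
                      exp (2 * of_real pi * \<i> * of_int n * of_real ((u - a) / (2 * \<delta>)))
                        / (2 * of_real pi * \<i> * of_int n))) f c d J \<and>
           (\<forall>n. n \<noteq> 0 \<longrightarrow>
              has_rs_integral
                (\<lambda>u. exp (2 * of_real pi * \<i> * of_int n * of_real ((u - a) / (2 * \<delta>)))) f c d (E n)) \<and>
           (\<lambda>N. \<Sum>n\<in>{- int N..int N} - {0}. 1 / (2 * of_real pi * \<i> * of_int n) * E n)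
             \<longlonglongrightarrow> J)
        \<longrightarrow>
        (\<lambda>N. \<Sum>n\<in>{- int N..int N}. cf n * exp (of_real pi * \<i> * of_int n * of_real a / of_real \<delta>))
          \<longlonglongrightarrow> (fp + fm) / 2) \<and>
       (\<lambda>N. (\<Sum>l = 1..N. \<Sum>n\<in>{- int l..int l}.
                cf n * exp (of_real pi * \<i> * of_int n * of_real a / of_real \<delta>)) / of_nat N)
         \<longlonglongrightarrow> (fp + fm) / 2)"
proof -
  define p where "p = 2 * \<delta>"
  have p: "p = d - c" "p > 0" and \<delta>: "\<delta> > 0" using assms(1,2) unfolding p_def by auto
  have osc: "osc_null f c d" using assms(3) by (rule riemann_integrable_osc_null)
  have oscL: "osc_null f c a" by (rule osc_null_left[OF osc]) (use assms(4,5) in auto)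
  have oscR: "osc_null f a d" by (rule osc_null_right[OF osc]) (use assms(4,5) in auto)
  have lens: "a - c < p" "d - a < p" using assms(4,5) p by auto
  have f: "f absolutely_integrable_on {c..d}"
    by (rule osc_null_absolutely_integrable[OF osc]) (use assms(1) in auto)
  then have f_int: "f integrable_on {c..d}" by (rule set_lebesgue_integral_eq_integral(1))
  let ?psi = "\<lambda>u. complex_of_real (psi ((u - a) / p))"
  define IL where "IL = fm / 2 - of_real (1 / 2 - (a - c) / p) * f c - 1 / of_real p * integral {c..a} f"
  define IR where "IR = of_real (1 / 2 - (d - a) / p) * f d - fp / 2 + 1 / of_real p * integral {a..d} f"
  note left = osc_null_integral_psi_left[OF oscL assms(4) lens(1), of fm, folded IL_def]
  note right = osc_null_integral_psi_right[OF oscR assms(5) lens(2), of fp, folded IR_def]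
  have partI: "\<exists>I. has_rs_integral_left ?psi f c a I \<and> (f a = fm \<longrightarrow> has_rs_integral ?psi f c a I) \<and>
      fm / 2 = 1 / of_real p * integral {c..a} f + I + f c * of_real (1 / 2 - (a - c) / p)"
    if "(f \<longlongrightarrow> fm) (at_left a)"
    using left[OF that] by (intro exI[of _ IL]) (simp add: IL_def mult.commute)
  have partII: "\<exists>I. has_rs_integral_right (\<lambda>u. of_real (psi ((a - u) / p))) f a d I \<and>
      (f a = fp \<longrightarrow> has_rs_integral (\<lambda>u. of_real (psi ((a - u) / p))) f a d I) \<and>
      fp / 2 = 1 / of_real p * integral {a..d} f - I + f d * of_real (1 / 2 - (d - a) / p)"
    if "(f \<longlongrightarrow> fp) (at_right a)"
    using right[OF that] by (intro exI[of _ IR]) (simp add: IR_def mult.commute)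
  have partIII:
    "(\<exists>I. has_rs_integral_around a ?psi f c d I \<and>
        (f a = fp \<and> f a = fm \<longrightarrow> has_rs_integral ?psi f c d I) \<and>
        (fp + fm) / 2 = 1 / of_real p * integral {c..d} f + I)"
    "(\<exists>J E. has_rs_integral_around a
         (\<lambda>u. lim (\<lambda>N. \<Sum>n\<in>{- int N..int N} - {0}.
              exp (2 * of_real pi * \<i> * of_int n * of_real ((u - a) / p)) / (2 * of_real pi * \<i> * of_int n))) f c d J \<and>
       (\<forall>n. n \<noteq> 0 \<longrightarrow> has_rs_integral
            (\<lambda>u. exp (2 * of_real pi * \<i> * of_int n * of_real ((u - a) / p))) f c d (E n)) \<and>
       (\<lambda>N. \<Sum>n\<in>{- int N..int N} - {0}. 1 / (2 * of_real pi * \<i> * of_int n) * E n) \<longlonglongrightarrow> J) \<Longrightarrow>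
     (\<lambda>N. \<Sum>n\<in>{- int N..int N}. cf n * exp (of_real pi * \<i> * of_int n * of_real a / of_real \<delta>))
        \<longlonglongrightarrow> (fp + fm) / 2"
    "(\<lambda>N. (\<Sum>l = 1..N. \<Sum>n\<in>{- int l..int l}.
          cf n * exp (of_real pi * \<i> * of_int n * of_real a / of_real \<delta>)) / of_nat N) \<longlonglongrightarrow> (fp + fm) / 2"
    if limp: "(f \<longlongrightarrow> fp) (at_right a)" and limm: "(f \<longlongrightarrow> fm) (at_left a)" and fcd: "f c = f d"
  proof -
    define I where "I = (fp + fm) / 2 - 1 / of_real p * integral {c..d} f"
    have "1 / of_real p * integral {c..d} f = 1 / of_real p * integral {c..a} f + 1 / of_real p * integral {a..d} f"
      using Henstock_Kurzweil_Integration.integral_combine[of c a d f] assms(4,5) f_int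
      by (simp flip: add_divide_distrib)
    \<comment> \<open>The endpoint terms of (I) and (II) cancel: \<open>f c = f d\<close>, and the
      two fractions of the period add up to 1.\<close>
    moreover have "of_real (1 / 2 - (a - c) / p) * f c + of_real (1 / 2 - (d - a) / p) * f d = 0"
    proof -
      have "(a - c) / p + (d - a) / p = p / p" unfolding add_divide_distrib[symmetric] by (simp add: p(1))
      then have "(1 / 2 - (a - c) / p) + (1 / 2 - (d - a) / p) = 0" using p(2) by simp
      then show ?thesis unfolding fcd distrib_right[symmetric] of_real_add[symmetric] by simp
    qed
    ultimately have I: "I = IL + - IR" unfolding I_def IL_def IR_def by (simp add: algebra_simps add_divide_distrib)
    \<comment> \<open>\<open>psi\<close> is odd off the integers, which converts the integrand of
      (II) into that of (III).\<close>
    have psi_minus: "psi ((u - a) / p) = - psi ((a - u) / p)" if "u \<in> {a<..d}" for u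
    proof -
      have w: "0 < (u - a) / p" "(u - a) / p < 1" using that lens p(2) by auto
      have e: "(a - u) / p = - ((u - a) / p)" by (simp add: diff_divide_distrib)
      show ?thesis unfolding e using w psi_nonneg[of "(u - a) / p"] psi_neg[of "- ((u - a) / p)"] by simp
    qed
    have "has_rs_integral_right ?psi f a d (- IR)"
      by (subst has_rs_integral_right_cong[OF _]) (use has_rs_integral_right_minus[OF right(1)[OF limp]] psi_minus in auto)
    with left(1)[OF limm] have around: "has_rs_integral_around a ?psi f c d I"
      unfolding has_rs_integral_around_def I by blast
    moreover have "has_rs_integral ?psi f c d I" if "f a = fp" "f a = fm"
    proof -
      have "isCont f a" using limp limm that by (simp add: continuous_at filterlim_split_at_real)
      from osc_null_integral_psi_continuous[OF osc assms(4,5) p(1) this fcd] show ?thesis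
        unfolding I_def that(1) using that by simp
    qed
    ultimately show "\<exists>I. has_rs_integral_around a ?psi f c d I \<and>
        (f a = fp \<and> f a = fm \<longrightarrow> has_rs_integral ?psi f c d I) \<and>
        (fp + fm) / 2 = 1 / of_real p * integral {c..d} f + I"
      by (intro exI[of _ I]) (auto simp: I_def)
    define g where "g n = cf n * exp (of_real pi * \<i> * of_int n * of_real a / of_real \<delta>)" for n
    define S where "S N = (\<Sum>n\<in>{- int N..int N}. g n)" for N
    note fourier = fourier_partial_sum_integral[OF f \<delta> assms(6), folded p_def]
    have "(\<lambda>N. 1 / of_real p * ((\<Sum>l=1..N. integral {c..d} (\<lambda>u. f u * of_real (dirichlet_kernel l ((u - a) / p)))) / of_nat N))
      \<longlonglongrightarrow> 1 / of_real p * (of_real p * ((fp + fm) / 2))"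
      by (intro tendsto_intros fejer_mean_tendsto[OF assms(4,5) p(1) f limm limp])
    moreover have "(\<Sum>l=1..N. S l) / of_nat N =
       1 / of_real p * ((\<Sum>l=1..N. integral {c..d} (\<lambda>u. f u * of_real (dirichlet_kernel l ((u - a) / p)))) / of_nat N)" for N
      unfolding S_def g_def fourier(2) sum_distrib_left[symmetric] by simp
    ultimately show "(\<lambda>N. (\<Sum>l=1..N. \<Sum>n\<in>{- int l..int l}.
        cf n * exp (of_real pi * \<i> * of_int n * of_real a / of_real \<delta>)) / of_nat N) \<longlonglongrightarrow> (fp + fm) / 2"
      unfolding S_def g_def using p(2) by simp
    assume "\<exists>J E. has_rs_integral_around a
         (\<lambda>u. lim (\<lambda>N. \<Sum>n\<in>{- int N..int N} - {0}.
              exp (2 * of_real pi * \<i> * of_int n * of_real ((u - a) / p)) / (2 * of_real pi * \<i> * of_int n))) f c d J \<and>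
       (\<forall>n. n \<noteq> 0 \<longrightarrow> has_rs_integral
            (\<lambda>u. exp (2 * of_real pi * \<i> * of_int n * of_real ((u - a) / p))) f c d (E n)) \<and>
       (\<lambda>N. \<Sum>n\<in>{- int N..int N} - {0}. 1 / (2 * of_real pi * \<i> * of_int n) * E n) \<longlonglongrightarrow> J"
    then obtain J E where J: "has_rs_integral_around a
         (\<lambda>u. lim (\<lambda>N. \<Sum>n\<in>{- int N..int N} - {0}.
              exp (2 * of_real pi * \<i> * of_int n * of_real ((u - a) / p)) / (2 * of_real pi * \<i> * of_int n))) f c d J"
      and E: "\<And>n. n \<noteq> 0 \<Longrightarrow> has_rs_integral
            (\<lambda>u. exp (2 * of_real pi * \<i> * of_int n * of_real ((u - a) / p))) f c d (E n)"
      and EJ: "(\<lambda>N. \<Sum>n\<in>{- int N..int N} - {0}. 1 / (2 * of_real pi * \<i> * of_int n) * E n) \<longlonglongrightarrow> J"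
      by blast
    have "lim (\<lambda>N. complex_of_real (sawtooth_sum N ((u - a) / p))) = - ?psi u" if "u \<in> {c..d}" "u \<noteq> a" for u
    proof -
      have "(\<lambda>N. sawtooth_sum N ((u - a) / p)) \<longlonglongrightarrow> - psi ((u - a) / p)"
        using that lens p(2) by (intro sawtooth_sum_tendsto_psi) (auto simp: pos_less_divide_eq)
      from tendsto_of_real[OF this, where 'a = complex] show ?thesis by (intro limI) simp
    qed
    then have "has_rs_integral_around a (\<lambda>u. - ?psi u) f c d J"
      using J assms(4,5) unfolding sum_exp_sawtooth_sum
      by (subst has_rs_integral_around_cong[where g' = "\<lambda>u. lim (\<lambda>N. complex_of_real (sawtooth_sum N ((u - a) / p)))"]) auto
    then have "J = - I"
      using has_rs_integral_around_unique[OF assms(4,5)] has_rs_integral_around_minus[OF around] by blast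
    \<comment> \<open>The factor \<open>n\<close> gained by integration by parts cancels the
      denominator. The exponentials in \<open>E\<close> have the sign opposite to those in the
      coefficients, hence \<open>- n\<close>.\<close>
    have coeff: "1 / (2 * of_real pi * \<i> * of_int n) * E n = - g (- n)"
      if "n \<noteq> 0" for n
      unfolding g_def fourier(1) rs_integral_exp[OF osc assms(1,2) fcd E[OF that, unfolded p_def], folded p_def]
      using that by simp
    \<comment> \<open>The interchanged series lacks the index 0. The missing term
      \<open>cf 0\<close> is the mean value of \<open>f\<close>, the same term that separates
      \<open>I\<close> from the mean of the one-sided limits.\<close>
    have "(\<Sum>n\<in>{- int N..int N} - {0}. 1 / (2 * of_real pi * \<i> * of_int n) * E n) = cf 0 - S N" for N
    proof -
      have "(\<Sum>n\<in>{- int N..int N} - {0}. 1 / (2 * of_real pi * \<i> * of_int n) * E n) =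
        (\<Sum>n\<in>{- int N..int N} - {0}. - g n)"
        by (rule sum.reindex_bij_witness[of _ uminus uminus]) (auto simp flip: coeff)
      moreover have "g 0 = cf 0" by (simp add: g_def)
      ultimately show ?thesis unfolding S_def sum_symmetric_int_zero by (simp add: sum_negf)
    qed
    with EJ have "(\<lambda>N. cf 0 - S N) \<longlonglongrightarrow> J" by simp
    from tendsto_diff[OF tendsto_const[of "cf 0"] this] have "S \<longlonglongrightarrow> cf 0 - J" by simp
    moreover have "cf 0 = 1 / of_real p * integral {c..d} f" unfolding assms(6) p_def by simp
    then have "cf 0 - J = (fp + fm) / 2" unfolding \<open>J = - I\<close> I_def by simp
    ultimately show "(\<lambda>N. \<Sum>n\<in>{- int N..int N}. cf n * exp (of_real pi * \<i> * of_int n * of_real a / of_real \<delta>))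
        \<longlonglongrightarrow> (fp + fm) / 2" unfolding S_def g_def by simp
  qed
  show ?thesis
    unfolding p_def[symmetric] using partI partII partIII by blast
qed

end
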